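(* Let $\beta_\star\in\mathbf R^d\setminus\{0\}$, $M_\star=\beta_\star\beta_\star^\top$, and $y=\langle x,\beta_\star\rangle^2+\varepsilon$, where $x\sim\mathsf D_x\in\mathcal P_4(\mathbf R^d)$ and $\varepsilon$ is independent of $x$ with zero mean and finite variance; let $\mathsf D$ be the joint law of $(x,y)$. For each of the two phase retrieval problems $$\text{(a)}\quad \min_{M\in\mathbf S^d_+:\ \mathrm{rank}(M)=1}\ \mathbb E_{(x,y)\sim\mathsf D}\tfrac12\big(x^\top Mx-y\big)^2,\qquad \text{(b)}\quad \min_{\beta\in\mathbf R^d\setminus\{0\}}\ \mathbb E_{(x,y)\sim\mathsf D}\tfrac18\big(\langle x,\beta\rangle^2-y\big)^2,$$ the radius of statistical efficiency is $$\mathrm{RSE}(\mathsf D)=\min_{v\in\mathbb S^{d-1}}\sqrt{\mathbb E_{x\sim\mathsf D_x}\Big[\Big\langle x,\tfrac{\beta_\star}{\|\beta_\star\|_2}\Big\rangle^2\wedge\langle x,v\rangle^2\Big]}.$$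
   Context: $\mathcal P_4(\mathbf R^d)$ is the set of Borel probability measures on $\mathbf R^d$ with finite fourth moment; $a\wedge b=\min\{a,b\}$; $\mathbb S^{d-1}$ is the unit sphere; $\mathbf S^d_+$ is the cone of PSD matrices in the space $\mathbf S^d$ of symmetric matrices with trace inner product. $W_2(\mu,\nu)=\min_{\pi\in\Pi(\mu,\nu)}(\mathbb E_{(x,y)\sim\pi}\|x-y\|_2^2)^{1/2}$ over couplings, $W_2(\mu,\mathcal E)=\inf_{\nu\in\mathcal E}W_2(\mu,\nu)$. Tilt-stability: for a $C^2$ embedded submanifold $\mathcal M$ of a Euclidean space and $C^2$-smooth $f$ on $\mathcal M$, a minimizer $\theta_\star$ of $f$ over $\mathcal M$ is tilt-stable if for some $\epsilon>0$ the map $\sigma(v)=\operatorname{argmin}_{\theta\in\mathcal M\cap B_\epsilon(\theta_\star)}\{f(\theta)-\langle v,\theta\rangle\}$ satisfies $\sigma(0)=\theta_\star$ and is single-valued and $C^1$-smooth on a neighborhood of the origin. RSE (supervised, permissible feature distributions $\mathcal P_4(\mathbf R^d)$): $\mathcal E$ is the set of $\mu\in\mathcal P_4(\mathbf R^d)$ for which the true parameter ($M_\star$ in (a), $\beta_\star$ in (b)) is not a tilt-stable minimizer of the problem in which $x\sim\mu$ and the conditional law of $y$ given $x$ is unchanged; $\mathrm{RSE}(\mathsf D)=W_2(\mathsf D_x,\mathcal E)$. *)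

theory Defs
  imports "HOL-Probability.Probability"
begin

section \<open>Tilt-stability\<close>

definition argmin_set :: "('p \<Rightarrow> real) \<Rightarrow> 'p set \<Rightarrow> 'p set" where
  "argmin_set f S = {\<theta>. is_arg_min f (\<lambda>\<theta>. \<theta> \<in> S) \<theta>}"

text \<open>For \<open>U\<close> relatively open in a subspace \<open>E\<close> this is continuous differentiability of \<open>s\<close> as a
  function on an open subset of the Euclidean space \<open>E\<close>: a derivative at \<open>v\<close>, which is determined
  on \<open>E\<close> only, extends to the whole type by composition with the orthogonal projection onto \<open>E\<close>.\<close>

definition C1_on :: "'p::euclidean_space set \<Rightarrow> ('p \<Rightarrow> 'p) \<Rightarrow> bool" where
  "C1_on U s \<longleftrightarrow> (\<exists>s' :: 'p \<Rightarrow> 'p \<Rightarrow>\<^sub>L 'p.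
     (\<forall>v\<in>U. (s has_derivative blinfun_apply (s' v)) (at v within U)) \<and> continuous_on U s')"

text \<open>\<open>E\<close> is the ambient Euclidean space, given as a linear subspace of the type; tilts range over
  \<open>E\<close>. The notion is meant for a \<open>C\<^sup>2\<close> embedded submanifold \<open>\<M> \<subseteq> E\<close> and an objective \<open>f\<close> that is
  \<open>C\<^sup>2\<close> on \<open>\<M>\<close>; the condition itself makes sense without this.\<close>

definition tilt_stable_minimizer ::
    "'p::euclidean_space set \<Rightarrow> 'p set \<Rightarrow> ('p \<Rightarrow> real) \<Rightarrow> 'p \<Rightarrow> bool" where
  "tilt_stable_minimizer E \<M> f \<theta> \<longleftrightarrow>
     \<theta> \<in> argmin_set f \<M> \<and>
     (\<exists>\<epsilon>>0. \<exists>U s. openin (top_of_set E) U \<and> 0 \<in> U \<and>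
        (\<forall>v\<in>U. argmin_set (\<lambda>\<theta>'. f \<theta>' - v \<bullet> \<theta>') (\<M> \<inter> cball \<theta> \<epsilon>) = {s v}) \<and>
        s 0 = \<theta> \<and> C1_on U s)"


section \<open>Wasserstein distance\<close>

definition P4 :: "'a::euclidean_space measure set" where
  "P4 = {\<mu>. prob_space \<mu> \<and> sets \<mu> = sets borel \<and> integrable \<mu> (\<lambda>x. norm x ^ 4)}"

definition couplings ::
    "'a::euclidean_space measure \<Rightarrow> 'a measure \<Rightarrow> ('a \<times> 'a) measure set" where
  "couplings \<mu> \<nu> = {\<pi>. sets \<pi> = sets borel \<and> distr \<pi> borel fst = \<mu> \<and> distr \<pi> borel snd = \<nu>}"

definition W2 :: "'a::euclidean_space measure \<Rightarrow> 'a measure \<Rightarrow> real" where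
  "W2 \<mu> \<nu> = (INF \<pi>\<in>couplings \<mu> \<nu>. sqrt (\<integral>z. (norm (fst z - snd z))\<^sup>2 \<partial>\<pi>))"

text \<open>Extended real, so that the distance to the empty set is \<open>\<infinity>\<close>.\<close>

definition W2_setdist :: "'a::euclidean_space measure \<Rightarrow> 'a measure set \<Rightarrow> ereal" where
  "W2_setdist \<mu> A = (INF \<nu>\<in>A. ereal (W2 \<mu> \<nu>))"


section \<open>Radius of statistical efficiency for supervised problems\<close>

definition joint_law ::
    "'a::euclidean_space measure \<Rightarrow> ('a \<Rightarrow> real measure) \<Rightarrow> ('a \<times> real) measure" where
  "joint_law \<mu> K = \<mu> \<bind> (\<lambda>x. distr (K x) borel (\<lambda>y. (x, y)))"

definition expected_loss ::
    "('p \<Rightarrow> 'a \<Rightarrow> real \<Rightarrow> real) \<Rightarrow> ('a::euclidean_space \<times> real) measure \<Rightarrow> 'p \<Rightarrow> real" where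
  "expected_loss loss D \<theta> = (\<integral>(x, y). loss \<theta> x y \<partial>D)"

definition exceptional_laws ::
    "'p::euclidean_space set \<Rightarrow> 'p set \<Rightarrow> ('p \<Rightarrow> 'a \<Rightarrow> real \<Rightarrow> real) \<Rightarrow> 'p
      \<Rightarrow> ('a::euclidean_space \<Rightarrow> real measure) \<Rightarrow> 'a measure set" where
  "exceptional_laws E \<M> loss \<theta> K =
     {\<mu> \<in> P4. \<not> tilt_stable_minimizer E \<M> (expected_loss loss (joint_law \<mu> K)) \<theta>}"

text \<open>\<open>K\<close> is the conditional law of \<open>y\<close> given \<open>x\<close>. It is a separate argument because \<open>D\<close> determines
  it only almost everywhere with respect to the law of \<open>x\<close>, while the exceptional laws need it
  at every \<open>x\<close>.\<close>

definition RSE ::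
    "'p::euclidean_space set \<Rightarrow> 'p set \<Rightarrow> ('p \<Rightarrow> 'a \<Rightarrow> real \<Rightarrow> real) \<Rightarrow> 'p
      \<Rightarrow> ('a::euclidean_space \<Rightarrow> real measure) \<Rightarrow> ('a \<times> real) measure \<Rightarrow> ereal" where
  "RSE E \<M> loss \<theta> K D = W2_setdist (distr D borel fst) (exceptional_laws E \<M> loss \<theta> K)"


section \<open>Phase retrieval\<close>

definition phase_kernel ::
    "'a::euclidean_space \<Rightarrow> real measure \<Rightarrow> 'a \<Rightarrow> real measure" where
  "phase_kernel \<beta> N x = distr N borel (\<lambda>e. (x \<bullet> \<beta>)\<^sup>2 + e)"

text \<open>The library's \<open>indep_var\<close> requires both variables to have the same type.\<close>

definition indep_of ::
    "'w measure \<Rightarrow> ('w \<Rightarrow> 'a::topological_space) \<Rightarrow> ('w \<Rightarrow> 'b::topological_space) \<Rightarrow> bool" where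
  "indep_of \<Omega> X Y \<longleftrightarrow> prob_space.indep_set \<Omega>
     {X -` A \<inter> space \<Omega> | A. A \<in> sets borel} {Y -` B \<inter> space \<Omega> | B. B \<in> sets borel}"

lemma phase_joint_law:
  fixes x :: "'w \<Rightarrow> 'a::euclidean_space" and \<epsilon> :: "'w \<Rightarrow> real" and \<beta> :: 'a
  assumes "prob_space \<Omega>"
    and x[measurable]: "x \<in> borel_measurable \<Omega>" and e[measurable]: "\<epsilon> \<in> borel_measurable \<Omega>"
    and ind: "indep_of \<Omega> x \<epsilon>"
  shows "distr \<Omega> borel (\<lambda>\<omega>. (x \<omega>, (x \<omega> \<bullet> \<beta>)\<^sup>2 + \<epsilon> \<omega>)) =
    joint_law (distr \<Omega> borel x) (phase_kernel \<beta> (distr \<Omega> borel \<epsilon>))"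
proof -
  interpret prob_space \<Omega> by fact
  let ?X = "distr \<Omega> borel x" and ?N = "distr \<Omega> borel \<epsilon>"
  interpret X: prob_space ?X by (rule prob_space_distr) simp
  interpret N: prob_space ?N by (rule prob_space_distr) simp
  interpret XN: pair_prob_space ?X ?N ..
  let ?g = "\<lambda>z::'a \<times> real. (fst z, (fst z \<bullet> \<beta>)\<^sup>2 + snd z)"
  let ?k = "\<lambda>a. distr (phase_kernel \<beta> ?N a) borel (\<lambda>y. (a, y))"
  have g[measurable]: "?g \<in> borel \<Otimes>\<^sub>M borel \<rightarrow>\<^sub>M borel \<Otimes>\<^sub>M borel" by measurable
  have k: "?k a = distr ?N (borel \<Otimes>\<^sub>M borel) (\<lambda>e. ?g (a, e))" for a
    unfolding phase_kernel_def by (subst distr_distr) (auto simp: borel_prod comp_def)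
  have N_sub: "?N \<in> space (subprob_algebra borel)"
    by (simp add: space_subprob_algebra N.subprob_space_axioms)
  have kmeas: "?k \<in> ?X \<rightarrow>\<^sub>M subprob_algebra (borel \<Otimes>\<^sub>M borel)"
    unfolding k
  proof (rule measurable_distr2[where M="borel"])
    have "(\<lambda>(a, e). ?g (a, e)) \<in> borel \<Otimes>\<^sub>M borel \<rightarrow>\<^sub>M borel \<Otimes>\<^sub>M borel"
      using g by (simp add: case_prod_beta)
    then show "(\<lambda>(a, e). ?g (a, e)) \<in> ?X \<Otimes>\<^sub>M borel \<rightarrow>\<^sub>M borel \<Otimes>\<^sub>M borel"
      by (subst measurable_cong_sets[OF sets_pair_measure_cong[OF sets_distr refl] refl])
    show "(\<lambda>a. ?N) \<in> ?X \<rightarrow>\<^sub>M subprob_algebra borel"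
      using N_sub by (rule measurable_const)
  qed
  have pair: "distr \<Omega> (borel \<Otimes>\<^sub>M borel) (\<lambda>\<omega>. (x \<omega>, \<epsilon> \<omega>)) = ?X \<Otimes>\<^sub>M ?N"
  proof (rule pair_measure_eqI[symmetric])
    show "sigma_finite_measure ?X" "sigma_finite_measure ?N"
      by (rule X.sigma_finite_measure_axioms N.sigma_finite_measure_axioms)+
    show "sets (?X \<Otimes>\<^sub>M ?N) = sets (distr \<Omega> (borel \<Otimes>\<^sub>M borel) (\<lambda>\<omega>. (x \<omega>, \<epsilon> \<omega>)))"
      by (simp cong: sets_pair_measure_cong)
    fix A B assume "A \<in> sets ?X" "B \<in> sets ?N"
    then have A[measurable]: "A \<in> sets borel" and B[measurable]: "B \<in> sets borel" by auto
    have "prob ((x -` A \<inter> space \<Omega>) \<inter> (\<epsilon> -` B \<inter> space \<Omega>)) =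
        prob (x -` A \<inter> space \<Omega>) * prob (\<epsilon> -` B \<inter> space \<Omega>)"
      by (rule indep_setD[OF ind[unfolded indep_of_def]]) (use A B in blast)+
    moreover have "(\<lambda>\<omega>. (x \<omega>, \<epsilon> \<omega>)) -` (A \<times> B) \<inter> space \<Omega> =
        (x -` A \<inter> space \<Omega>) \<inter> (\<epsilon> -` B \<inter> space \<Omega>)" by auto
    ultimately show "emeasure ?X A * emeasure ?N B =
        emeasure (distr \<Omega> (borel \<Otimes>\<^sub>M borel) (\<lambda>\<omega>. (x \<omega>, \<epsilon> \<omega>))) (A \<times> B)"
      by (simp add: emeasure_distr emeasure_eq_measure ennreal_mult)
  qed
  have "distr \<Omega> borel (\<lambda>\<omega>. (x \<omega>, (x \<omega> \<bullet> \<beta>)\<^sup>2 + \<epsilon> \<omega>)) = distr (?X \<Otimes>\<^sub>M ?N) (borel \<Otimes>\<^sub>M borel) ?g"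
    unfolding pair[symmetric] by (subst distr_distr[OF g]) (auto simp: borel_prod comp_def)
  also have "\<dots> = ?X \<bind> ?k"
  proof (rule measure_eqI)
    show "sets (distr (?X \<Otimes>\<^sub>M ?N) (borel \<Otimes>\<^sub>M borel) ?g) = sets (?X \<bind> ?k)"
      by (simp add: sets_bind[OF sets_kernel[OF kmeas]] borel_prod)
    fix A assume "A \<in> sets (distr (?X \<Otimes>\<^sub>M ?N) (borel \<Otimes>\<^sub>M borel) ?g)"
    then have A[measurable]: "A \<in> sets (borel \<Otimes>\<^sub>M borel)" by simp
    have "emeasure (?X \<bind> ?k) A = (\<integral>\<^sup>+a. emeasure (?k a) A \<partial>?X)"
      by (rule emeasure_bind[OF _ kmeas A]) simp
    also have "\<dots> = (\<integral>\<^sup>+a. (\<integral>\<^sup>+e. indicator A (?g (a, e)) \<partial>?N) \<partial>?X)"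
      unfolding k
      by (intro nn_integral_cong)
         (subst nn_integral_indicator[symmetric], simp, subst nn_integral_distr, auto)
    also have "\<dots> = (\<integral>\<^sup>+z. indicator A (?g z) \<partial>(?X \<Otimes>\<^sub>M ?N))"
      by (rule N.nn_integral_fst) measurable
    also have "\<dots> = emeasure (distr (?X \<Otimes>\<^sub>M ?N) (borel \<Otimes>\<^sub>M borel) ?g) A"
      by (subst nn_integral_indicator[symmetric], simp, subst nn_integral_distr, auto)
    finally show "emeasure (distr (?X \<Otimes>\<^sub>M ?N) (borel \<Otimes>\<^sub>M borel) ?g) A = emeasure (?X \<bind> ?k) A" ..
  qed
  finally show ?thesis unfolding joint_law_def .
qed

text \<open>The inner product and norm of \<^typ>\<open>real ^ 'n ^ 'n\<close> are the trace inner product and the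
  Frobenius norm.\<close>

definition sym_mats :: "(real ^ 'n ^ 'n) set" where
  "sym_mats = {M. transpose M = M}"

definition psd_mats :: "(real ^ 'n ^ 'n) set" where
  "psd_mats = {M \<in> sym_mats. \<forall>u. 0 \<le> u \<bullet> (M *v u)}"

definition outer :: "real ^ 'n \<Rightarrow> real ^ 'n ^ 'n" where
  "outer u = (\<chi> i j. u $ i * u $ j)"

definition matrix_loss :: "real ^ 'n ^ 'n \<Rightarrow> real ^ 'n \<Rightarrow> real \<Rightarrow> real" where
  "matrix_loss M x y = 1/2 * (x \<bullet> (M *v x) - y)\<^sup>2"

definition vector_loss :: "real ^ 'n \<Rightarrow> real ^ 'n \<Rightarrow> real \<Rightarrow> real" where
  "vector_loss \<beta> x y = 1/8 * ((x \<bullet> \<beta>)\<^sup>2 - y)\<^sup>2"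

definition is_minimum :: "'b::linorder set \<Rightarrow> 'b \<Rightarrow> bool" where
  "is_minimum S r \<longleftrightarrow> r \<in> S \<and> (\<forall>s\<in>S. r \<le> s)"

end

theory Submission
  imports Defs
begin

text \<open>Both objectives are, up to a positive factor and the noise variance, the function
  \<open>\<beta> \<mapsto> E (\<langle>x, \<beta>\<rangle>\<^sup>2 - \<langle>x, \<beta>\<^sub>\<star>\<rangle>\<^sup>2)\<^sup>2\<close>, for the rank-one problem through the local parametrization
  \<open>\<beta> \<mapsto> \<beta> \<beta>\<^sup>T\<close>. Its Hessian at \<open>\<beta>\<^sub>\<star>\<close> is a multiple of \<open>v \<mapsto> E \<langle>x, \<beta>\<^sub>\<star>\<rangle>\<^sup>2 \<langle>x, v\<rangle>\<^sup>2\<close>. If it is positive definite, the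
  tilted problems have a unique continuously differentiable solution near \<open>\<beta>\<^sub>\<star>\<close>. If it vanishes at
  some \<open>v\<close>, the objective grows only quartically along \<open>v\<close>, which excludes a solution map that is
  Lipschitz at zero tilt. So in both problems the exceptional laws are those carried by
  \<open>\<beta>\<^sub>\<star>\<^sup>\<bottom> \<union> v\<^sup>\<bottom>\<close> for some unit vector \<open>v\<close>. For fixed \<open>v\<close> the nearest such law is obtained by
  projecting every point onto the nearer of the two hyperplanes, at squared cost
  \<open>E min (\<langle>x, \<beta>\<^sub>\<star> / \<parallel>\<beta>\<^sub>\<star>\<parallel>\<rangle>\<^sup>2, \<langle>x, v\<rangle>\<^sup>2)\<close>, which is continuous in \<open>v\<close> and hence attains its minimum on
  the sphere.\<close>

subsection \<open>Difference quotients and coercive operators\<close>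

text \<open>Caratheodory's form of differentiability: with an exact slope identity the remainder is
  \<open>(L x - L y) (x - y)\<close>, so continuity of the slope at \<open>y\<close> suffices.
  Derivatives below are read off algebraic factorizations this way.\<close>

lemma has_derivative_slope:
  fixes f :: "'a::real_normed_vector \<Rightarrow> 'b::real_normed_vector" and L :: "'a \<Rightarrow> 'a \<Rightarrow>\<^sub>L 'b"
  assumes "\<And>x. x \<in> S \<Longrightarrow> f x - f y = L x (x - y)" and "(L \<longlongrightarrow> L y) (at y within S)"
  shows "(f has_derivative blinfun_apply (L y)) (at y within S)"
proof (rule has_derivativeI_sandwich[where e=1 and H="\<lambda>x. norm (L x - L y)"])
  show "norm (f x - f y - L y (x - y)) / norm (x - y) \<le> norm (L x - L y)"
    if "x \<in> S" "x \<noteq> y" for x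
  proof -
    have "f x - f y - L y (x - y) = (L x - L y) (x - y)"
      using assms(1)[OF that(1)] by (simp add: blinfun.diff_left)
    then show ?thesis
      using norm_blinfun[of "L x - L y" "x - y"] that(2) by (simp add: divide_le_eq)
  qed
  show "((\<lambda>x. norm (L x - L y)) \<longlongrightarrow> 0) (at y within S)"
    using assms(2) LIM_zero tendsto_norm_zero by blast
qed (auto intro: blinfun.bounded_linear_right)

definition coercive :: "real \<Rightarrow> ('a::euclidean_space \<Rightarrow>\<^sub>L 'a) \<Rightarrow> bool" where
  "coercive c A \<longleftrightarrow> (\<forall>h. c * (norm h)\<^sup>2 \<le> h \<bullet> A h)"

text \<open>Meaningful where the inverse function is linear, which coercivity with a positive
  constant guarantees; elsewhere \<open>Blinfun\<close> may return a junk value.\<close>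

definition blinfun_inv :: "('a::euclidean_space \<Rightarrow>\<^sub>L 'a) \<Rightarrow> ('a \<Rightarrow>\<^sub>L 'a)" where
  "blinfun_inv A = Blinfun (inv (blinfun_apply A))"

lemma coercive_norm_le:
  assumes "coercive c A"
  shows "c * norm h \<le> norm (A h)"
proof (cases "h = 0")
  case False
  have "norm h * (c * norm h) \<le> h \<bullet> A h"
    using assms by (simp add: coercive_def power2_eq_square algebra_simps)
  also have "\<dots> \<le> norm h * norm (A h)" by (rule norm_cauchy_schwarz)
  finally show ?thesis using False by simp
qed simp

lemma coercive_perturb:
  assumes "coercive c A" "norm (A' - A) \<le> d"
  shows "coercive (c - d) A'"
  unfolding coercive_def
proof
  fix h
  have "h \<bullet> A' h = h \<bullet> A h + h \<bullet> (A' - A) h"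
    by (simp add: blinfun.diff_left inner_diff_right)
  moreover have "\<bar>h \<bullet> (A' - A) h\<bar> \<le> d * (norm h)\<^sup>2"
  proof -
    have "\<bar>h \<bullet> (A' - A) h\<bar> \<le> norm h * norm ((A' - A) h)" by (rule Cauchy_Schwarz_ineq2)
    also have "\<dots> \<le> norm h * (norm (A' - A) * norm h)"
      by (intro mult_left_mono norm_blinfun) simp
    also have "\<dots> \<le> norm h * (d * norm h)"
      using assms(2) by (intro mult_left_mono mult_right_mono) auto
    finally show ?thesis by (simp add: power2_eq_square algebra_simps)
  qed
  ultimately show "(c - d) * (norm h)\<^sup>2 \<le> h \<bullet> A' h"
    using assms(1) unfolding coercive_def by (simp add: algebra_simps) (smt (verit))
qed

text \<open>Coercivity bounds \<open>A\<close> from below, hence gives injectivity, and in finite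
  dimension injectivity gives surjectivity.\<close>

lemma
  assumes "coercive c A" "0 < c"
  shows blinfun_inv_left: "blinfun_inv A (A y) = y"
    and blinfun_inv_right: "A (blinfun_inv A y) = y"
proof -
  have lin: "linear (blinfun_apply A)"
    by (simp add: blinfun.bounded_linear_right bounded_linear.linear)
  have inj: "inj (blinfun_apply A)"
    unfolding linear_injective_0[OF lin]
  proof safe
    fix h assume "A h = 0"
    with coercive_norm_le[OF assms(1), of h] assms(2) show "h = 0"
      by (simp add: mult_le_0_iff)
  qed
  have surj: "surj (blinfun_apply A)" by (rule linear_inj_imp_surj[OF lin inj])
  have "linear (inv (blinfun_apply A))"
    by (rule inj_linear_imp_inv_linear[OF lin inj])
  then have inv: "blinfun_apply (blinfun_inv A) = inv (blinfun_apply A)"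
    unfolding blinfun_inv_def by (simp add: bounded_linear_Blinfun_apply linear_conv_bounded_linear)
  show "blinfun_inv A (A y) = y" unfolding inv by (simp add: inj)
  show "A (blinfun_inv A y) = y" unfolding inv by (simp add: surj surj_f_inv_f)
qed

text \<open>The difference of two inverses is one inverse times \<open>A' - A\<close> times the
  other. Each inverse has norm at most 1/c, so inversion is Lipschitz with constant 1/c^2 on
  operators sharing a coercivity constant.\<close>

lemma continuous_on_blinfun_inv:
  assumes "0 < c"
  shows "continuous_on {A. coercive c A} blinfun_inv"
proof -
  have bd: "norm (blinfun_inv A y) \<le> norm y / c" if "coercive c A" for A :: "'a \<Rightarrow>\<^sub>L 'a" and y
    using coercive_norm_le[OF that, of "blinfun_inv A y"] assms
    by (simp add: blinfun_inv_right[OF that] field_simps)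
  have "norm (blinfun_inv A - blinfun_inv A') \<le> 1 / c\<^sup>2 * norm (A - A')"
    if A: "coercive c A" "coercive c A'" for A A' :: "'a \<Rightarrow>\<^sub>L 'a"
  proof (rule norm_blinfun_bound)
    fix y
    have "(blinfun_inv A - blinfun_inv A') y = blinfun_inv A ((A' - A) (blinfun_inv A' y))"
      using A assms
      by (simp add: blinfun.diff_left blinfun.diff_right blinfun_inv_left blinfun_inv_right)
    also have "norm \<dots> \<le> norm ((A' - A) (blinfun_inv A' y)) / c" by (rule bd[OF A(1)])
    also have "\<dots> \<le> norm (A' - A) * (norm y / c) / c"
      using assms
      by (intro divide_right_mono order_trans[OF norm_blinfun] mult_left_mono bd[OF A(2)]) auto
    also have "\<dots> = 1 / c\<^sup>2 * norm (A - A') * norm y"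
      by (simp add: power2_eq_square norm_minus_commute)
    finally show "norm ((blinfun_inv A - blinfun_inv A') y) \<le> 1 / c\<^sup>2 * norm (A - A') * norm y" .
  qed simp
  then have "(1 / c\<^sup>2)-lipschitz_on {A. coercive c A} (blinfun_inv :: ('a \<Rightarrow>\<^sub>L 'a) \<Rightarrow> _)"
    by (intro lipschitz_onI) (auto simp: dist_norm)
  then show ?thesis by (rule lipschitz_on_continuous_on)
qed

subsection \<open>Tilt-stability through a parametrization\<close>

text \<open>Restricting the solution map to tilts in \<open>E\<close> keeps it single-valued and
  continuously differentiable. This lets the rank-one problem be studied with tilts by arbitrary
  matrices.\<close>

lemma tilt_stable_minimizer_subspace:
  assumes "tilt_stable_minimizer UNIV M f \<theta>" "0 \<in> E"
  shows "tilt_stable_minimizer E M f \<theta>"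
proof -
  obtain e U s where U: "0 < e" "open U" "0 \<in> U"
    "\<forall>v\<in>U. argmin_set (\<lambda>\<theta>'. f \<theta>' - v \<bullet> \<theta>') (M \<inter> cball \<theta> e) = {s v}" "s 0 = \<theta>" "C1_on U s"
    and m: "\<theta> \<in> argmin_set f M"
    using assms(1) unfolding tilt_stable_minimizer_def by (auto simp: openin_subtopology)
  have "C1_on (E \<inter> U) s"
  proof -
    obtain s' where s': "\<And>v. v \<in> U \<Longrightarrow> (s has_derivative blinfun_apply (s' v)) (at v within U)"
      "continuous_on U s'"
      using U(6) unfolding C1_on_def by blast
    have "(s has_derivative blinfun_apply (s' v)) (at v within E \<inter> U)" if "v \<in> E \<inter> U" for v
      using that by (intro has_derivative_subset[OF s'(1)]) auto
    moreover have "continuous_on (E \<inter> U) s'" using s'(2) by (rule continuous_on_subset) simp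
    ultimately show ?thesis unfolding C1_on_def by blast
  qed
  moreover have "openin (top_of_set E) (E \<inter> U)" using U(2) by auto
  ultimately show ?thesis
    unfolding tilt_stable_minimizer_def using U m assms(2)
    by (intro conjI exI[of _ e] exI[of _ "E \<inter> U"] exI[of _ s]) auto
qed

text \<open>The stationarity equation of the tilted problem in the parameter space is linearised exactly
  by difference quotients: two stationary points \<open>a\<close>, \<open>a'\<close> for tilts \<open>V\<close>, \<open>V'\<close> satisfy
  \<open>(A (a, a') - B V') (a - a') = T a (V - V')\<close>. Uniqueness, Lipschitz continuity and continuous
  differentiability of the solution map are all read off this identity.\<close>

lemma tilt_stable_minimizer_param:
  fixes \<phi> :: "'a::euclidean_space \<Rightarrow> 'p::euclidean_space" and f :: "'p \<Rightarrow> real"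
    and L :: "'a \<times> 'a \<Rightarrow> 'a" and A :: "'a \<times> 'a \<Rightarrow> 'a \<Rightarrow>\<^sub>L 'a" and P :: "'a \<times> 'a \<Rightarrow> 'a \<Rightarrow>\<^sub>L 'p"
    and T :: "'a \<Rightarrow> 'p \<Rightarrow>\<^sub>L 'a" and B :: "'p \<Rightarrow>\<^sub>L ('a \<Rightarrow>\<^sub>L 'a)"
  assumes L: "\<And>a a'. f (\<phi> a) - f (\<phi> a') = L (a, a') \<bullet> (a - a')" "continuous_on UNIV L"
    and A: "\<And>a a'. L (a, a) - L (a', a') = A (a, a') (a - a')" "continuous_on UNIV A"
    and c: "coercive c (A (b, b))" "0 < c"
    and strict: "0 < r1" "\<And>a. a \<in> cball b r1 \<Longrightarrow> a \<noteq> b \<Longrightarrow> f (\<phi> b) < f (\<phi> a)"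
    and P: "\<And>a a'. \<phi> a - \<phi> a' = P (a, a') (a - a')" "continuous_on UNIV P"
    and T: "\<And>a V h. V \<bullet> P (a, a) h = T a V \<bullet> h" "continuous_on UNIV T"
      "\<And>a a' V. T a V - T a' V = B V (a - a')"
    and into: "0 < r2" "\<And>a. a \<in> cball b r2 \<Longrightarrow> \<phi> a \<in> M"
    and onto: "\<And>r. 0 < r \<Longrightarrow> \<exists>e>0. M \<inter> cball (\<phi> b) e \<subseteq> \<phi> ` cball b r"
    and min: "\<phi> b \<in> argmin_set f M"
  shows "tilt_stable_minimizer UNIV M f (\<phi> b)"
proof -
  have der_f: "((\<lambda>a. f (\<phi> a)) has_derivative (\<lambda>h. L (a, a) \<bullet> h)) (at a)" for a
  proof -
    have "((\<lambda>a'. L (a', a)) \<longlongrightarrow> L (a, a)) (at a)"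
      using isCont_o2[of a "\<lambda>a'. (a', a)" L] L(2)
      by (simp add: continuous_on_eq_continuous_at continuous_at tendsto_Pair)
    then have "((\<lambda>a'. blinfun_inner_right (L (a', a))) \<longlongrightarrow> blinfun_inner_right (L (a, a))) (at a)"
      by (intro tendsto_intros)
    from has_derivative_slope[OF _ this, of "\<lambda>a. f (\<phi> a)"] show ?thesis
      by (simp add: L(1))
  qed
  have der_\<phi>: "(\<phi> has_derivative P (a, a)) (at a)" for a
  proof -
    have "((\<lambda>a'. P (a', a)) \<longlongrightarrow> P (a, a)) (at a)"
      using isCont_o2[of a "\<lambda>a'. (a', a)" P] P(2)
      by (simp add: continuous_on_eq_continuous_at continuous_at tendsto_Pair)
    from has_derivative_slope[OF _ this, of \<phi>] show ?thesis by (simp add: P(1))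
  qed
  have cont_f: "continuous_on X (\<lambda>a. f (\<phi> a))" for X
    by (intro continuous_at_imp_continuous_on ballI has_derivative_continuous[OF der_f])
  have cont_\<phi>: "continuous_on X \<phi>" for X
    by (intro continuous_at_imp_continuous_on ballI has_derivative_continuous[OF der_\<phi>])
  have "\<forall>\<^sub>F p in nhds (b, b). dist (A p) (A (b, b)) < c / 4"
    using A(2) c(2)
    by (intro tendstoD) (auto simp: continuous_on_eq_continuous_at continuous_at tendsto_at_iff_tendsto_nhds)
  then obtain d where d: "0 < d" "\<And>p. dist p (b, b) < d \<Longrightarrow> dist (A p) (A (b, b)) < c / 4"
    unfolding eventually_nhds_metric by blast
  \<comment> \<open>Both entries of a pair may be off by \<open>r\<close>, so the pair is within
    2d/3 of (b, b).\<close>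
  define r where "r = min (d / 3) (min r1 r2)"
  \<comment> \<open>Chosen so that \<open>B V\<close> costs at most c/4; with another c/4 from
    moving the base points, coercivity c/2 remains. The added 1 keeps the denominator positive when
    \<open>B\<close> is zero.\<close>
  define \<delta>0 where "\<delta>0 = c / (4 * (norm B + 1))"
  have r: "0 < r" "r \<le> r1" "r \<le> r2" "r \<le> d / 3" using d strict into by (auto simp: r_def)
  have \<delta>0: "0 < \<delta>0" using c(2) by (simp add: \<delta>0_def add_nonneg_pos)
  have coer: "coercive (c / 2) (A (a, a') - B V)"
    if "a \<in> cball b r" "a' \<in> cball b r" "norm V < \<delta>0" for a a' V
  proof -
    have "dist (a, a') (b, b) \<le> dist a b + dist a' b"
      by (simp add: dist_Pair_Pair sqrt_sum_squares_le_sum)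
    also have "\<dots> < d" using that r d(1) by (auto simp: dist_commute)
    finally have 1: "norm (A (a, a') - A (b, b)) < c / 4" using d(2) by (simp add: dist_norm)
    have "norm (B V) \<le> norm B * norm V" by (rule norm_blinfun)
    also have "\<dots> \<le> (norm B + 1) * \<delta>0" using that(3) by (intro mult_mono) auto
    also have "\<dots> = c / 4"
    proof -
      have "norm B + 1 \<noteq> 0" using norm_ge_zero[of B] by linarith
      then show ?thesis unfolding \<delta>0_def by (simp add: divide_simps)
    qed
    finally have "norm (A (a, a') - B V - A (b, b)) \<le> c / 2"
      using 1 norm_triangle_ineq4[of "A (a, a') - A (b, b)" "B V"] by (simp add: algebra_simps)
    from coercive_perturb[OF c(1) this] show ?thesis by (simp add: field_simps)
  qed
  obtain \<epsilon> where \<epsilon>: "0 < \<epsilon>" "M \<inter> cball (\<phi> b) \<epsilon> \<subseteq> \<phi> ` cball b r" using onto[OF r(1)] by blast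
  \<comment> \<open>Compact parameter set whose image is exactly the feasible set near
    \<open>\<phi> b\<close>, so the tilted problems move to the parameter space.\<close>
  define C where "C = cball b r \<inter> \<phi> -` cball (\<phi> b) \<epsilon>"
  have C: "M \<inter> cball (\<phi> b) \<epsilon> = \<phi> ` C"
    using \<epsilon>(2) into(2) r(3) by (fastforce simp: C_def)
  have bC: "b \<in> C" using r \<epsilon> by (simp add: C_def)
  have cC: "compact C" unfolding C_def
    by (intro compact_Int_closed compact_cball closed_vimage cont_\<phi> closed_cball)
  \<comment> \<open>The points of \<open>C\<close> at which one of the two distance constraints is
    active. By compactness and strict minimality of \<open>b\<close>, the objective exceeds its
    value at \<open>b\<close> by a fixed gap there.\<close>
  define Bd where "Bd = C - {a. dist b a < r \<and> dist (\<phi> b) (\<phi> a) < \<epsilon>}"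
  have "open {a. dist b a < r \<and> dist (\<phi> b) (\<phi> a) < \<epsilon>}"
    by (intro open_Collect_conj open_Collect_less continuous_intros cont_\<phi>)
  then have cBd: "compact Bd" unfolding Bd_def by (intro compact_diff cC)
  have "\<exists>m>0. \<forall>a\<in>Bd. f (\<phi> b) + m \<le> f (\<phi> a)"
  proof (cases "Bd = {}")
    case False
    obtain a0 where a0: "a0 \<in> Bd" "\<And>a. a \<in> Bd \<Longrightarrow> f (\<phi> a0) \<le> f (\<phi> a)"
      using continuous_attains_inf[OF cBd False cont_f] by blast
    have "a0 \<noteq> b" "a0 \<in> cball b r1" using a0(1) r \<epsilon> by (auto simp: Bd_def C_def)
    then show ?thesis using a0(2) strict(2)[of a0]
      by (intro exI[of _ "f (\<phi> a0) - f (\<phi> b)"]) auto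
  qed (auto intro: exI[of _ 1])
  then obtain m where m: "0 < m" "\<And>a. a \<in> Bd \<Longrightarrow> f (\<phi> b) + m \<le> f (\<phi> a)" by blast
  \<comment> \<open>A tilt of norm below m/\<epsilon> gains less than the gap \<open>m\<close> over
    a distance of at most \<epsilon>, so tilted minimizers stay off \<open>Bd\<close>.\<close>
  define \<delta> where "\<delta> = min \<delta>0 (m / \<epsilon>)"
  have \<delta>: "0 < \<delta>" "\<delta> \<le> \<delta>0" "\<delta> \<le> m / \<epsilon>" using \<delta>0 m(1) \<epsilon>(1) by (auto simp: \<delta>_def)
  define F where "F V a = f (\<phi> a) - V \<bullet> \<phi> a" for V a
  define Q where "Q V a \<longleftrightarrow> a \<in> C \<and> (\<forall>a'\<in>C. F V a \<le> F V a')" for V a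
  \<comment> \<open>Off \<open>Bd\<close> both constraints are strict, so the minimizer is interior
    and Fermat's rule applies; \<open>T a V\<close> is the gradient at \<open>a\<close> of the tilt
    term in the parameter.\<close>
  have stationary: "L (a, a) = T a V" if V: "norm V < \<delta>" and Q: "Q V a" for V a
  proof -
    have "a \<notin> Bd"
    proof
      assume "a \<in> Bd"
      then have "m \<le> f (\<phi> a) - f (\<phi> b)" using m(2)[of a] by simp
      also have "\<dots> \<le> V \<bullet> (\<phi> a - \<phi> b)"
        using Q bC by (auto simp: Q_def F_def inner_diff_right)
      also have "\<dots> \<le> norm V * norm (\<phi> a - \<phi> b)" by (rule norm_cauchy_schwarz)
      also have "\<dots> \<le> norm V * \<epsilon>"
        using Q by (intro mult_left_mono) (auto simp: Q_def C_def dist_norm norm_minus_commute)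
      also have "\<dots> < m" using V \<delta>(3) \<epsilon>(1) by (smt (verit) pos_le_divide_eq mult_right_mono mult_strict_right_mono)
      finally show False by simp
    qed
    moreover have "a \<in> C" using Q by (simp add: Q_def)
    ultimately have a: "a \<in> {a. dist b a < r \<and> dist (\<phi> b) (\<phi> a) < \<epsilon>}" (is "a \<in> ?S")
      by (simp add: Bd_def)
    have "?S \<subseteq> C" by (auto simp: C_def)
    then have "\<forall>a'\<in>?S. F V a \<le> F V a'" using Q by (auto simp: Q_def)
    moreover have "(F V has_derivative (\<lambda>h. L (a, a) \<bullet> h - V \<bullet> P (a, a) h)) (at a)"
      unfolding F_def by (intro derivative_intros der_f der_\<phi>)
    ultimately have "(\<lambda>h. L (a, a) \<bullet> h - V \<bullet> P (a, a) h) = (\<lambda>h. 0)"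
      using differential_zero_maxmin[OF a] \<open>open ?S\<close> by blast
    then have "(L (a, a) - T a V) \<bullet> h = 0" for h by (simp add: T(1) inner_diff_left fun_eq_iff)
    then show ?thesis using inner_eq_zero_iff by (metis eq_iff_diff_eq_0)
  qed
  define Ki where "Ki p V = blinfun_inv (A p - B V)" for p V
  have diff: "a - a' = Ki (a, a') V' (T a (V - V'))"
    if "norm V < \<delta>" "norm V' < \<delta>" "Q V a" "Q V' a'" for V V' a a'
  proof -
    have "A (a, a') (a - a') = T a V - T a' V'"
      using stationary[of V a] stationary[of V' a'] that A(1)[of a a'] by simp
    also have "\<dots> = T a (V - V') + B V' (a - a')"
      unfolding T(3)[of a V' a', symmetric] by (simp add: blinfun.diff_right)
    finally have "T a (V - V') = (A (a, a') - B V') (a - a')" by (simp add: blinfun.diff_left)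
    moreover have "coercive (c / 2) (A (a, a') - B V')"
      using that \<delta> by (intro coer) (auto simp: Q_def C_def)
    ultimately show ?thesis using c(2) by (simp add: Ki_def blinfun_inv_left)
  qed
  have "\<exists>a. Q V a" for V
  proof -
    have "continuous_on C (F V)" unfolding F_def by (intro continuous_intros cont_f cont_\<phi>)
    then show ?thesis using continuous_attains_inf[OF cC _] bC unfolding Q_def by blast
  qed
  then obtain s where s: "\<And>V. Q V (s V)" by metis
  have uniq: "a = s V" if "norm V < \<delta>" "Q V a" for V a
    using diff[OF that(1) that(1) that(2) s] by (simp add: blinfun.zero_right)
  have argmin: "argmin_set (\<lambda>\<theta>. f \<theta> - V \<bullet> \<theta>) (M \<inter> cball (\<phi> b) \<epsilon>) = {\<phi> (s V)}"
    if "norm V < \<delta>" for V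
  proof -
    have "argmin_set (\<lambda>\<theta>. f \<theta> - V \<bullet> \<theta>) (M \<inter> cball (\<phi> b) \<epsilon>) = \<phi> ` {a. Q V a}"
      unfolding C argmin_set_def is_arg_min_def Q_def F_def by (force simp: not_less)
    also have "{a. Q V a} = {s V}" using uniq[OF that] s by blast
    finally show ?thesis by simp
  qed
  have "Q 0 b" using bC r(2) strict(2) by (force simp: Q_def F_def C_def less_eq_real_def)
  then have s0: "s 0 = b" using uniq[of 0 b] \<delta>(1) by simp
  have sC: "s V \<in> cball b r" for V using s[of V] by (simp add: Q_def C_def)
  have sdiff: "s V - s V' = Ki (s V, s V') V' (T (s V) (V - V'))"
    if "V \<in> ball 0 \<delta>" "V' \<in> ball 0 \<delta>" for V V'
    using diff[of V V' "s V" "s V'"] that s by simp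
  have coer_s: "coercive (c / 2) (A (s V, s V') - B V')" if "V' \<in> ball 0 \<delta>" for V V'
    using that \<delta>(2) by (intro coer sC) auto
  \<comment> \<open>The slope of \<open>s\<close> in \<open>sdiff\<close> contains \<open>s\<close>
    itself. A uniform bound on that slope gives Lipschitz continuity first, and only then does the
    slope converge on the diagonal.\<close>
  have conts: "continuous_on (ball 0 \<delta>) s"
  proof -
    have "bounded (T ` cball b r)"
      by (intro compact_imp_bounded compact_continuous_image continuous_on_subset[OF T(2)]) auto
    then obtain t where "\<forall>x\<in>T ` cball b r. norm x \<le> t"
      unfolding bounded_iff ..
    then have t: "norm (T a) \<le> t" if "a \<in> cball b r" for a using that by simp
    have "0 \<le> norm (T b)" by simp
    also have "\<dots> \<le> t" using r(1) by (intro t) simp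
    finally have "t \<ge> 0" .
    have "dist (s V) (s V') \<le> 2 / c * t * dist V V'"
      if "V \<in> ball 0 \<delta>" "V' \<in> ball 0 \<delta>" for V V'
    proof -
      have "c / 2 * norm (s V - s V') \<le> norm ((A (s V, s V') - B V') (s V - s V'))"
        by (rule coercive_norm_le[OF coer_s[OF that(2)]])
      also have "\<dots> = norm (T (s V) (V - V'))"
        unfolding sdiff[OF that] Ki_def
        using c(2) by (simp add: blinfun_inv_right[OF coer_s[OF that(2)]])
      also have "\<dots> \<le> t * norm (V - V')"
        by (intro order_trans[OF norm_blinfun] mult_right_mono t sC) simp
      finally show ?thesis using c(2) by (simp add: dist_norm field_simps)
    qed
    then have "(2 / c * t)-lipschitz_on (ball 0 \<delta>) s"
      using c(2) \<open>t \<ge> 0\<close> by (intro lipschitz_onI) auto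
    then show ?thesis by (rule lipschitz_on_continuous_on)
  qed
  \<comment> \<open>The slope of the solution map: the slope of \<phi> composed with that of
    \<open>s\<close>. Its diagonal is the derivative, and its joint continuity gives both
    differentiability and continuity of the derivative.\<close>
  define S where "S W V = P (s W, s V) o\<^sub>L Ki (s W, s V) V o\<^sub>L T (s W)" for W V
  have contS: "continuous_on (ball 0 \<delta> \<times> ball 0 \<delta>) (\<lambda>p. S (fst p) (snd p))"
  proof -
    have 1: "continuous_on (ball 0 \<delta> \<times> ball 0 \<delta>) (\<lambda>p. s (fst p))"
      "continuous_on (ball 0 \<delta> \<times> ball 0 \<delta>) (\<lambda>p. s (snd p))"
      by (auto intro!: continuous_on_compose2[OF conts] continuous_intros)
    show ?thesis unfolding S_def Ki_def
      using c(2)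
      by (intro bounded_bilinear.continuous_on[OF bounded_bilinear_blinfun_compose]
          continuous_on_compose2[OF P(2)] continuous_on_compose2[OF T(2)]
          continuous_on_compose2[OF continuous_on_blinfun_inv[of "c / 2"]]
          continuous_on_compose2[OF A(2)] continuous_intros 1)
        (auto intro!: coer_s)
  qed
  have "C1_on (ball 0 \<delta>) (\<lambda>V. \<phi> (s V))"
    unfolding C1_on_def
  proof (intro exI[of _ "\<lambda>V. S V V"] conjI ballI)
    fix V :: 'p assume V: "V \<in> ball 0 \<delta>"
    have "continuous_on (ball 0 \<delta>) (\<lambda>W. S W V)"
      using V by (rule_tac continuous_on_compose2[OF contS, of _ "\<lambda>W. (W, V)", simplified])
        (auto intro!: continuous_intros)
    then have "((\<lambda>W. S W V) \<longlongrightarrow> S V V) (at V within ball 0 \<delta>)"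
      using V by (simp add: continuous_on_def)
    then show "((\<lambda>V. \<phi> (s V)) has_derivative blinfun_apply (S V V)) (at V within ball 0 \<delta>)"
      by (rule has_derivative_slope[rotated])
        (use V P(1) sdiff in \<open>simp add: S_def\<close>)
  next
    show "continuous_on (ball 0 \<delta>) (\<lambda>V. S V V)"
      by (rule continuous_on_compose2[OF contS, of _ "\<lambda>W. (W, W)", simplified])
        (auto intro!: continuous_intros)
  qed
  then show ?thesis
    unfolding tilt_stable_minimizer_def
    by (intro conjI exI[of _ \<epsilon>] exI[of _ "ball 0 \<delta>"] exI[of _ "\<lambda>V. \<phi> (s V)"])
      (use min \<epsilon>(1) \<delta>(1) argmin s0 in auto)
qed

text \<open>The tilt \<open>t\<^sup>2 A\<close> makes the point \<open>p t\<close> gain order \<open>t\<^sup>3\<close> over \<open>\<theta>\<close>, whereas a solution map that is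
  Lipschitz at zero could gain only order \<open>t\<^sup>4\<close>.\<close>

lemma not_tilt_stable_minimizer_quartic:
  fixes A \<theta> :: "'p::euclidean_space"
  assumes E: "subspace E" "A \<in> E" and pos: "0 < a" "0 < \<delta>"
    and p: "\<And>t. 0 < t \<Longrightarrow> t < \<delta> \<Longrightarrow> p t \<in> M"
      "\<And>t. 0 < t \<Longrightarrow> t < \<delta> \<Longrightarrow> f (p t) \<le> f \<theta> + C * t ^ 4"
      "\<And>t. 0 < t \<Longrightarrow> t < \<delta> \<Longrightarrow> a * t - C * t\<^sup>2 \<le> A \<bullet> (p t - \<theta>)"
      "\<And>t. 0 < t \<Longrightarrow> t < \<delta> \<Longrightarrow> norm (p t - \<theta>) \<le> C * t"
  shows "\<not> tilt_stable_minimizer E M f \<theta>"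
proof
  assume "tilt_stable_minimizer E M f \<theta>"
  then obtain e U s where min: "\<theta> \<in> argmin_set f M" and e: "0 < e"
    and U: "openin (top_of_set E) U" "0 \<in> U"
    and s: "\<And>v. v \<in> U \<Longrightarrow> argmin_set (\<lambda>\<theta>'. f \<theta>' - v \<bullet> \<theta>') (M \<inter> cball \<theta> e) = {s v}" "s 0 = \<theta>"
    and C1: "C1_on U s"
    unfolding tilt_stable_minimizer_def by blast
  obtain \<eta> where \<eta>: "0 < \<eta>" "\<And>v. v \<in> E \<Longrightarrow> dist v 0 < \<eta> \<Longrightarrow> v \<in> U"
    using U unfolding openin_euclidean_subtopology_iff by blast
  obtain s' where s': "(s has_derivative blinfun_apply s') (at 0 within U)"
    using C1 U(2) unfolding C1_on_def by blast
  obtain d where d: "0 < d"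
    "\<And>v. v \<in> U \<Longrightarrow> norm v < d \<Longrightarrow> norm (s v - \<theta> - s' v) \<le> norm v"
    using s' unfolding has_derivative_within_alt s(2)
    by (metis diff_zero mult_1 zero_less_one)
  \<comment> \<open>Differentiability at zero tilt with error constant 1 makes \<open>K\<close> a
    Lipschitz constant of \<open>s\<close> at 0.\<close>
  define K where "K = norm s' + 1"
  have K: "norm (s v - \<theta>) \<le> K * norm v" if "v \<in> U" "norm v < d" for v
    using d(2)[OF that] norm_blinfun[of s' v] norm_triangle_sub[of "s v - \<theta>" "s' v"]
    by (simp add: K_def algebra_simps)
  have small: "\<forall>\<^sub>F t in at_right 0. g t < r" if "(g \<longlongrightarrow> 0) (at_right (0::real))" "0 < r" for g and r :: real
    using that by (rule order_tendstoD(2))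
  have "\<forall>\<^sub>F t in at_right (0::real). 0 < t \<and> t < \<delta> \<and> C * t < e \<and> t\<^sup>2 * norm A < min \<eta> d
      \<and> (2 * C + K * (norm A)\<^sup>2) * t < a"
    using pos e \<eta>(1) d(1)
    by (intro eventually_conj small eventually_at_right_less) (auto intro!: tendsto_eq_intros)
  \<comment> \<open>The bounds place \<open>p t\<close> in the ball of the tilted problem,
    \<open>t\<^sup>2 *\<^sub>R A\<close> in \<open>U\<close> and in the range of the Lipschitz
    bound; the last one yields the contradiction.\<close>
  then obtain t where t: "0 < t" "t < \<delta>" "C * t < e" "t\<^sup>2 * norm A < \<eta>" "t\<^sup>2 * norm A < d"
    "(2 * C + K * (norm A)\<^sup>2) * t < a"
    using eventually_happens[of _ "at_right (0::real)"] by auto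
  define v where "v = t\<^sup>2 *\<^sub>R A"
  have vE: "v \<in> E" using E by (simp add: v_def subspace_scale)
  then have vU: "v \<in> U" using \<eta>(2) t(4) by (simp add: v_def)
  have "p t \<in> M \<inter> cball \<theta> e"
    using p(1,4)[OF t(1,2)] t(3) by (auto simp: dist_norm norm_minus_commute)
  moreover have "s v \<in> argmin_set (\<lambda>\<theta>'. f \<theta>' - v \<bullet> \<theta>') (M \<inter> cball \<theta> e)" using s(1)[OF vU] by simp
  ultimately have "s v \<in> M" and opt: "f (s v) - v \<bullet> s v \<le> f (p t) - v \<bullet> p t"
    by (force simp: argmin_set_def is_arg_min_def not_less)+
  then have "f \<theta> \<le> f (s v)" using min by (force simp: argmin_set_def is_arg_min_def not_less)
  then have "v \<bullet> (p t - \<theta>) \<le> C * t ^ 4 + v \<bullet> (s v - \<theta>)"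
    using opt p(2)[OF t(1,2)] by (simp add: inner_diff_right)
  also have "v \<bullet> (s v - \<theta>) \<le> norm v * (K * norm v)"
    using K[OF vU] t(5) by (intro order_trans[OF norm_cauchy_schwarz] mult_left_mono) (auto simp: v_def)
  also have "norm v * (K * norm v) = K * (norm A)\<^sup>2 * t ^ 4"
    by (simp add: v_def power2_eq_square power4_eq_xxxx algebra_simps)
  also have "v \<bullet> (p t - \<theta>) = t\<^sup>2 * (A \<bullet> (p t - \<theta>))" by (simp add: v_def)
  finally have "t\<^sup>2 * (a * t - C * t\<^sup>2) \<le> C * t ^ 4 + K * (norm A)\<^sup>2 * t ^ 4"
    using mult_left_mono[OF p(3)[OF t(1,2)], of "t\<^sup>2"] by simp
  \<comment> \<open>Dividing by t^3 would bound \<open>a\<close> by a multiple of \<open>t\<close>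
    that the choice of \<open>t\<close> made smaller than \<open>a\<close>.\<close>
  then have "t ^ 3 * a \<le> t ^ 3 * ((2 * C + K * (norm A)\<^sup>2) * t)"
    by (simp add: power2_eq_square power3_eq_cube power4_eq_xxxx algebra_simps)
  then show False using t(1,6) by (simp add: mult_le_cancel_left_pos)
qed

subsection \<open>Wasserstein distance to laws on two hyperplanes\<close>

lemma P4_integrable:
  fixes f :: "'a::euclidean_space \<Rightarrow> 'b::euclidean_space"
  assumes "\<mu> \<in> P4" "f \<in> borel_measurable borel" "\<And>x. norm (f x) \<le> C * (1 + norm x ^ 4)"
  shows "integrable \<mu> f"
proof (rule Bochner_Integration.integrable_bound)
  interpret prob_space \<mu> using assms(1) by (simp add: P4_def)
  show "integrable \<mu> (\<lambda>x. C * (1 + norm x ^ 4))" using assms(1) by (simp add: P4_def)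
  show "f \<in> borel_measurable \<mu>"
    using assms(1,2) by (simp add: P4_def measurable_cong_sets[of \<mu> borel])
  show "AE x in \<mu>. norm (f x) \<le> norm (C * (1 + norm x ^ 4))"
    using assms(3) by (intro AE_I2) (auto intro: order_trans[OF _ abs_ge_self])
qed

lemma power2_le_one_plus_power4: "r\<^sup>2 \<le> 1 + r ^ 4" for r :: real
proof -
  have "1 + r ^ 4 - 2 * r\<^sup>2 = (r\<^sup>2 - 1)\<^sup>2"
    by (simp add: power2_eq_square power4_eq_xxxx algebra_simps)
  then show ?thesis using zero_le_power2[of r] zero_le_power2[of "r\<^sup>2 - 1"] by linarith
qed

lemma inner_power2_le: "(x \<bullet> u)\<^sup>2 \<le> (norm x)\<^sup>2" if "norm u = 1"
  using Cauchy_Schwarz_ineq2[of x u] that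
  by (metis abs_le_square_iff abs_norm_cancel mult.right_neutral)

lemma P4_sets: "\<mu> \<in> P4 \<Longrightarrow> sets \<mu> = sets borel" and P4_prob_space: "\<mu> \<in> P4 \<Longrightarrow> prob_space \<mu>"
  by (auto simp: P4_def)

lemma distr_pair_borel:
  assumes "prob_space M" "sets M = sets borel" "prob_space N" "sets N = sets borel"
  shows "distr (M \<Otimes>\<^sub>M N) borel fst = M" "distr (M \<Otimes>\<^sub>M N) borel snd = N"
proof -
  interpret M: prob_space M by fact
  interpret N: prob_space N by fact
  show "distr (M \<Otimes>\<^sub>M N) borel fst = M"
    using N.distr_pair_fst[of M] assms(2) by (simp cong: distr_cong)
  have "distr (M \<Otimes>\<^sub>M N) N snd = N"
  proof (rule measure_eqI)
    fix B assume "B \<in> sets (distr (M \<Otimes>\<^sub>M N) N snd)"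
    then have B: "B \<in> sets N" by simp
    then have "snd -` B \<inter> space (M \<Otimes>\<^sub>M N) = space M \<times> B"
      using sets.sets_into_space by (auto simp: space_pair_measure)
    then show "emeasure (distr (M \<Otimes>\<^sub>M N) N snd) B = emeasure N B"
      using B by (simp add: emeasure_distr N.emeasure_pair_measure_Times M.emeasure_space_1)
  qed simp
  then show "distr (M \<Otimes>\<^sub>M N) borel snd = N"
    using assms(4) by (simp cong: distr_cong)
qed

text \<open>The independent coupling keeps the real-valued infimum in \<open>W2\<close> from being
  taken over an empty set.\<close>

lemma pair_measure_in_couplings:
  assumes "\<mu> \<in> P4" "\<nu> \<in> P4"
  shows "\<mu> \<Otimes>\<^sub>M \<nu> \<in> couplings \<mu> \<nu>"
proof -
  have "sets (\<mu> \<Otimes>\<^sub>M \<nu>) = sets borel"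
    by (metis sets_pair_measure_cong P4_sets assms borel_prod)
  then show ?thesis
    using assms by (simp add: couplings_def distr_pair_borel P4_sets P4_prob_space)
qed

text \<open>If y is orthogonal to u, then <x, u>^2 = <x - y, u>^2 is at most the squared distance
  from x to y, and likewise for v. So the cost of every coupling dominates the minimum pointwise
  almost everywhere.\<close>

lemma W2_ge_two_hyperplanes:
  fixes u v :: "'a::euclidean_space"
  assumes \<mu>: "\<mu> \<in> P4" and \<nu>: "\<nu> \<in> P4" and uv: "norm u = 1" "norm v = 1"
    and AE0: "AE y in \<nu>. (y \<bullet> u) * (y \<bullet> v) = 0"
  shows "sqrt (\<integral>z. min ((z \<bullet> u)\<^sup>2) ((z \<bullet> v)\<^sup>2) \<partial>\<mu>) \<le> W2 \<mu> \<nu>"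
  unfolding W2_def
proof (rule cINF_greatest)
  show "couplings \<mu> \<nu> \<noteq> {}" using pair_measure_in_couplings[OF \<mu> \<nu>] by blast
next
  fix \<pi> assume "\<pi> \<in> couplings \<mu> \<nu>"
  then have \<pi>: "sets \<pi> = sets borel" "distr \<pi> borel fst = \<mu>" "distr \<pi> borel snd = \<nu>"
    by (auto simp: couplings_def)
  have fst: "fst \<in> \<pi> \<rightarrow>\<^sub>M borel" and snd: "snd \<in> \<pi> \<rightarrow>\<^sub>M borel"
    using \<pi>(1) by (auto simp: measurable_cong_sets[of \<pi> borel]
        intro!: borel_measurable_continuous_onI continuous_intros)
  have sq: "integrable \<mu> (\<lambda>x. (norm x)\<^sup>2)" "integrable \<nu> (\<lambda>x. (norm x)\<^sup>2)"
    by (rule P4_integrable[where C=1]; use \<mu> \<nu> power2_le_one_plus_power4 in simp)+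
  have "integrable \<pi> (\<lambda>z. (norm (fst z))\<^sup>2)" "integrable \<pi> (\<lambda>z. (norm (snd z))\<^sup>2)"
    by (rule integrable_distr[OF fst], simp add: \<pi> sq)
      (rule integrable_distr[OF snd], simp add: \<pi> sq)
  then have "integrable \<pi> (\<lambda>z. 2 * (norm (fst z))\<^sup>2 + 2 * (norm (snd z))\<^sup>2)" by simp
  \<comment> \<open>The Bochner integral of a non-integrable cost would be 0 by convention, so
    integrability is established before comparing integrals.\<close>
  then have int: "integrable \<pi> (\<lambda>z. (norm (fst z - snd z))\<^sup>2)"
  proof (rule Bochner_Integration.integrable_bound)
    show "(\<lambda>z. (norm (fst z - snd z))\<^sup>2) \<in> borel_measurable \<pi>"
      using fst snd by measurable
    have "(norm (x - y))\<^sup>2 \<le> 2 * (norm x)\<^sup>2 + 2 * (norm y)\<^sup>2" for x y :: 'a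
      using inner_ge_zero[of "x + y"]
      unfolding power2_norm_eq_inner by (simp add: inner_simps inner_commute)
    then show "AE z in \<pi>. norm ((norm (fst z - snd z))\<^sup>2)
        \<le> norm (2 * (norm (fst z))\<^sup>2 + 2 * (norm (snd z))\<^sup>2)" by (intro AE_I2) simp
  qed
  have min_int: "integrable \<mu> (\<lambda>z. min ((z \<bullet> u)\<^sup>2) ((z \<bullet> v)\<^sup>2))"
  proof (rule P4_integrable[OF \<mu>, where C=1])
    show "norm (min ((z \<bullet> u)\<^sup>2) ((z \<bullet> v)\<^sup>2)) \<le> 1 * (1 + norm z ^ 4)" for z
      using inner_power2_le[OF uv(1), of z] power2_le_one_plus_power4[of "norm z"]
      by (simp add: min_def)
  qed measurable
  have "AE z in \<pi>. (snd z \<bullet> u) * (snd z \<bullet> v) = 0"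
    using AE0 unfolding \<pi>(3)[symmetric] by (rule AE_distrD[OF snd])
  then have le: "AE z in \<pi>. min ((fst z \<bullet> u)\<^sup>2) ((fst z \<bullet> v)\<^sup>2) \<le> (norm (fst z - snd z))\<^sup>2"
  proof eventually_elim
    case (elim z)
    then show ?case
      using inner_power2_le[OF uv(1), of "fst z - snd z"] inner_power2_le[OF uv(2), of "fst z - snd z"]
      by (auto simp: inner_diff_left min.coboundedI1 min.coboundedI2)
  qed
  have "(\<integral>z. min ((z \<bullet> u)\<^sup>2) ((z \<bullet> v)\<^sup>2) \<partial>\<mu>) = (\<integral>z. min ((fst z \<bullet> u)\<^sup>2) ((fst z \<bullet> v)\<^sup>2) \<partial>\<pi>)"
    unfolding \<pi>(2)[symmetric] by (rule integral_distr[OF fst]) measurable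
  also have "\<dots> \<le> (\<integral>z. (norm (fst z - snd z))\<^sup>2 \<partial>\<pi>)"
    using min_int unfolding \<pi>(2)[symmetric]
    by (intro integral_mono_AE int le) (rule integrable_distr[OF fst])
  finally show "sqrt (\<integral>z. min ((z \<bullet> u)\<^sup>2) ((z \<bullet> v)\<^sup>2) \<partial>\<mu>) \<le> sqrt (\<integral>z. (norm (fst z - snd z))\<^sup>2 \<partial>\<pi>)"
    by simp
qed

text \<open>Moving each point to the nearer hyperplane is a transport map whose squared cost is
  exactly the minimum.\<close>

lemma W2_le_two_hyperplanes:
  fixes u v :: "'a::euclidean_space"
  assumes \<mu>: "\<mu> \<in> P4" and uv: "norm u = 1" "norm v = 1"
  shows "\<exists>\<nu>\<in>P4. (AE y in \<nu>. (y \<bullet> u) * (y \<bullet> v) = 0) \<and>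
    W2 \<mu> \<nu> \<le> sqrt (\<integral>z. min ((z \<bullet> u)\<^sup>2) ((z \<bullet> v)\<^sup>2) \<partial>\<mu>)"
proof -
  \<comment> \<open>The distance to the hyperplane orthogonal to a unit vector \<open>u\<close> is
    |<z, u>|; ties go to \<open>u\<close>.\<close>
  define T where "T z = (if \<bar>z \<bullet> u\<bar> \<le> \<bar>z \<bullet> v\<bar> then z - (z \<bullet> u) *\<^sub>R u else z - (z \<bullet> v) *\<^sub>R v)" for z
  have T[measurable]: "T \<in> borel_measurable borel" unfolding T_def[abs_def] by measurable
  note [measurable_cong] = P4_sets[OF \<mu>]
  interpret prob_space \<mu> by (rule P4_prob_space[OF \<mu>])
  have uu: "u \<bullet> u = 1" "v \<bullet> v = 1" using uv by (simp_all add: norm_eq_1)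
  have T0: "(T z \<bullet> u) * (T z \<bullet> v) = 0" for z
    using uu by (simp add: T_def inner_diff_left)
  have proj: "(norm (z - (z \<bullet> w) *\<^sub>R w))\<^sup>2 \<le> (norm z)\<^sup>2" if "w \<bullet> w = 1" for z w :: 'a
    using that unfolding power2_norm_eq_inner
    by (simp add: inner_diff_left inner_diff_right inner_commute)
  \<comment> \<open>An orthogonal projection does not increase norms, so the image law inherits the
    finite fourth moment.\<close>
  have nT: "norm (T z) \<le> norm z" for z
    using proj[OF uu(1), of z] proj[OF uu(2), of z] by (auto simp: T_def intro: power2_le_imp_le)
  have Tmin: "(norm (z - T z))\<^sup>2 = min ((z \<bullet> u)\<^sup>2) ((z \<bullet> v)\<^sup>2)" for z
    using uv by (auto simp: T_def min_def abs_le_square_iff)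
  define \<nu> where "\<nu> = distr \<mu> borel T"
  \<comment> \<open>The coupling carried by the graph of \<open>T\<close>.\<close>
  define \<pi> where "\<pi> = distr \<mu> borel (\<lambda>z. (z, T z))"
  have pair: "(\<lambda>z. (z, T z)) \<in> \<mu> \<rightarrow>\<^sub>M borel"
    unfolding borel_prod[symmetric] by measurable
  have "\<nu> \<in> P4"
  proof -
    have "integrable \<mu> (\<lambda>x. norm (T x) ^ 4)"
      by (rule P4_integrable[OF \<mu>, where C=1]) (auto intro!: add_increasing power_mono nT)
    then show ?thesis
      by (simp add: P4_def \<nu>_def prob_space_distr integrable_distr_eq)
  qed
  moreover have "AE y in \<nu>. (y \<bullet> u) * (y \<bullet> v) = 0"
    unfolding \<nu>_def by (subst AE_distr_iff) (auto simp: T0[simplified])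
  moreover have "W2 \<mu> \<nu> \<le> sqrt (\<integral>z. (norm (fst z - snd z))\<^sup>2 \<partial>\<pi>)"
    unfolding W2_def
  proof (rule cINF_lower)
    show "bdd_below ((\<lambda>\<pi>. sqrt (\<integral>z. (norm (fst z - snd z))\<^sup>2 \<partial>\<pi>)) ` couplings \<mu> \<nu>)"
      by (rule bdd_belowI[of _ 0]) auto
    have "distr \<pi> borel fst = \<mu>"
      unfolding \<pi>_def by (subst distr_distr[OF _ pair])
        (auto simp: comp_def P4_sets[OF \<mu>] intro!: distr_id2 borel_measurable_continuous_onI continuous_intros)
    moreover have "distr \<pi> borel snd = \<nu>"
      unfolding \<pi>_def \<nu>_def by (subst distr_distr[OF _ pair])
        (auto simp: comp_def intro!: borel_measurable_continuous_onI continuous_intros)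
    ultimately show "\<pi> \<in> couplings \<mu> \<nu>" by (simp add: couplings_def \<pi>_def)
  qed
  moreover have "(\<integral>z. (norm (fst z - snd z))\<^sup>2 \<partial>\<pi>) = (\<integral>z. min ((z \<bullet> u)\<^sup>2) ((z \<bullet> v)\<^sup>2) \<partial>\<mu>)"
    unfolding \<pi>_def Tmin[symmetric]
    by (subst integral_distr[OF pair])
      (auto intro!: borel_measurable_continuous_onI continuous_intros)
  ultimately show ?thesis by auto
qed

text \<open>The integrand is dominated by <z, u>^2, a bound independent of \<open>v\<close>, so
  dominated convergence applies.\<close>

lemma continuous_on_integral_min:
  fixes u :: "'a::euclidean_space"
  assumes \<mu>: "\<mu> \<in> P4" and u: "norm u = 1"
  shows "continuous_on S (\<lambda>v. \<integral>z. min ((z \<bullet> u)\<^sup>2) ((z \<bullet> v)\<^sup>2) \<partial>\<mu>)"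
proof (rule continuous_on_sequentiallyI)
  fix w :: "nat \<Rightarrow> 'a" and a assume "w \<longlonglongrightarrow> a"
  note [measurable_cong] = P4_sets[OF \<mu>]
  show "(\<lambda>n. \<integral>z. min ((z \<bullet> u)\<^sup>2) ((z \<bullet> w n)\<^sup>2) \<partial>\<mu>) \<longlonglongrightarrow> (\<integral>z. min ((z \<bullet> u)\<^sup>2) ((z \<bullet> a)\<^sup>2) \<partial>\<mu>)"
  proof (rule integral_dominated_convergence[where w="\<lambda>z. (z \<bullet> u)\<^sup>2"])
    show "integrable \<mu> (\<lambda>z. (z \<bullet> u)\<^sup>2)"
      using inner_power2_le[OF u] power2_le_one_plus_power4
      by (intro P4_integrable[OF \<mu>, where C=1]) (auto intro: order_trans)
    show "AE z in \<mu>. (\<lambda>n. min ((z \<bullet> u)\<^sup>2) ((z \<bullet> w n)\<^sup>2)) \<longlonglongrightarrow> min ((z \<bullet> u)\<^sup>2) ((z \<bullet> a)\<^sup>2)"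
      by (intro AE_I2 tendsto_intros \<open>w \<longlonglongrightarrow> a\<close>)
  qed (simp_all, measurable)
qed

section \<open>Distance to all laws carried by two hyperplanes\<close>

definition orthogonal_laws :: "'a::euclidean_space \<Rightarrow> 'a measure set" where
  "orthogonal_laws \<beta> = {\<nu> \<in> P4. \<exists>v\<in>sphere 0 1. AE y in \<nu>. (y \<bullet> \<beta>) * (y \<bullet> v) = 0}"

text \<open>Compactness of the sphere provides a best direction \<open>v0\<close>. Projection for
  \<open>v0\<close> bounds the distance from above; each law of the set, through its own direction,
  obeys the lower bound, which is at least the value at \<open>v0\<close>.\<close>

lemma W2_setdist_orthogonal_laws:
  fixes \<beta> :: "'a::euclidean_space"
  assumes \<mu>: "\<mu> \<in> P4" and \<beta>: "\<beta> \<noteq> 0"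
  shows "is_minimum
    ((\<lambda>v. ereal (sqrt (\<integral>z. min ((z \<bullet> (\<beta> /\<^sub>R norm \<beta>))\<^sup>2) ((z \<bullet> v)\<^sup>2) \<partial>\<mu>))) ` sphere 0 1)
    (W2_setdist \<mu> (orthogonal_laws \<beta>))"
proof -
  let ?u = "\<beta> /\<^sub>R norm \<beta>"
  let ?r = "\<lambda>v. sqrt (\<integral>z. min ((z \<bullet> ?u)\<^sup>2) ((z \<bullet> v)\<^sup>2) \<partial>\<mu>)"
  have u: "norm ?u = 1" using \<beta> by simp
  have eq: "(y \<bullet> ?u) * (y \<bullet> v) = 0 \<longleftrightarrow> (y \<bullet> \<beta>) * (y \<bullet> v) = 0" for y v using \<beta> by simp
  have "?u \<in> sphere 0 1" using u by simp
  then obtain v0 where v0: "v0 \<in> sphere 0 1" "\<And>v. v \<in> sphere 0 1 \<Longrightarrow> ?r v0 \<le> ?r v"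
    using continuous_attains_inf[of "sphere 0 1" ?r]
      continuous_on_real_sqrt[OF continuous_on_integral_min[OF \<mu> u]] compact_sphere by blast
  have "W2_setdist \<mu> (orthogonal_laws \<beta>) = ereal (?r v0)"
    unfolding W2_setdist_def
  proof (rule antisym)
    obtain \<nu> where \<nu>: "\<nu> \<in> P4" "AE y in \<nu>. (y \<bullet> ?u) * (y \<bullet> v0) = 0" "W2 \<mu> \<nu> \<le> ?r v0"
      using W2_le_two_hyperplanes[OF \<mu> u, of v0] v0(1) by auto
    then have "\<nu> \<in> orthogonal_laws \<beta>" unfolding eq orthogonal_laws_def using v0(1) by blast
    then show "(INF \<nu>\<in>orthogonal_laws \<beta>. ereal (W2 \<mu> \<nu>)) \<le> ereal (?r v0)"
      using \<nu>(3) by (intro INF_lower2) auto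
    show "ereal (?r v0) \<le> (INF \<nu>\<in>orthogonal_laws \<beta>. ereal (W2 \<mu> \<nu>))"
    proof (rule INF_greatest)
      fix \<nu> assume "\<nu> \<in> orthogonal_laws \<beta>"
      then obtain v where v: "\<nu> \<in> P4" "v \<in> sphere 0 1" "AE y in \<nu>. (y \<bullet> ?u) * (y \<bullet> v) = 0"
        unfolding orthogonal_laws_def eq by blast
      have "?r v0 \<le> ?r v" by (rule v0(2)[OF v(2)])
      also have "\<dots> \<le> W2 \<mu> \<nu>" using W2_ge_two_hyperplanes[OF \<mu> v(1) u _ v(3)] v(2) by simp
      finally show "ereal (?r v0) \<le> ereal (W2 \<mu> \<nu>)" by simp
    qed
  qed
  then show ?thesis unfolding is_minimum_def using v0 by auto
qed

subsection \<open>Fourth moments\<close>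

locale P4_law =
  fixes \<mu> :: "'a::euclidean_space measure"
  assumes P4: "\<mu> \<in> P4"
begin

definition moment4 :: "'a \<Rightarrow> 'a \<Rightarrow> 'a \<Rightarrow> 'a \<Rightarrow> real" where
  "moment4 u v w z = (\<integral>x. (x \<bullet> u) * (x \<bullet> v) * (x \<bullet> w) * (x \<bullet> z) \<partial>\<mu>)"

lemma integrable_vector: "integrable \<mu> (\<lambda>x. ((x \<bullet> u) * (x \<bullet> v) * (x \<bullet> w)) *\<^sub>R x)"
proof (rule P4_integrable[OF P4, where C="norm u * norm v * norm w"])
  show "norm (((x \<bullet> u) * (x \<bullet> v) * (x \<bullet> w)) *\<^sub>R x) \<le> norm u * norm v * norm w * (1 + norm x ^ 4)" for x
  proof -
    have "norm (((x \<bullet> u) * (x \<bullet> v) * (x \<bullet> w)) *\<^sub>R x) = \<bar>x \<bullet> u\<bar> * \<bar>x \<bullet> v\<bar> * \<bar>x \<bullet> w\<bar> * norm x"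
      by (simp add: abs_mult)
    also have "\<dots> \<le> (norm x * norm u) * (norm x * norm v) * (norm x * norm w) * norm x"
      by (intro mult_mono Cauchy_Schwarz_ineq2) auto
    also have "\<dots> = norm u * norm v * norm w * norm x ^ 4"
      by (simp add: power4_eq_xxxx)
    also have "\<dots> \<le> norm u * norm v * norm w * (1 + norm x ^ 4)"
      by (intro mult_left_mono) auto
    finally show ?thesis .
  qed
qed measurable

text \<open>The matrix E <x, u> <x, v> x x^T as an operator. This form makes continuity in (u, v),
  coercivity and inversion available.\<close>

definition moment_op :: "'a \<Rightarrow> 'a \<Rightarrow> 'a \<Rightarrow>\<^sub>L 'a" where
  "moment_op u v = Blinfun (\<lambda>w. \<integral>x. ((x \<bullet> u) * (x \<bullet> v) * (x \<bullet> w)) *\<^sub>R x \<partial>\<mu>)"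

lemma moment_op_apply: "moment_op u v w = (\<integral>x. ((x \<bullet> u) * (x \<bullet> v) * (x \<bullet> w)) *\<^sub>R x \<partial>\<mu>)"
proof -
  have "linear (\<lambda>w. \<integral>x. ((x \<bullet> u) * (x \<bullet> v) * (x \<bullet> w)) *\<^sub>R x \<partial>\<mu>)"
  proof (rule linearI)
    fix w z
    show "(\<integral>x. ((x \<bullet> u) * (x \<bullet> v) * (x \<bullet> (w + z))) *\<^sub>R x \<partial>\<mu>) =
      (\<integral>x. ((x \<bullet> u) * (x \<bullet> v) * (x \<bullet> w)) *\<^sub>R x \<partial>\<mu>) + (\<integral>x. ((x \<bullet> u) * (x \<bullet> v) * (x \<bullet> z)) *\<^sub>R x \<partial>\<mu>)"
      by (subst Bochner_Integration.integral_add[symmetric])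
        (simp_all add: integrable_vector inner_add_right distrib_left scaleR_add_left)
  next
    fix c w
    show "(\<integral>x. ((x \<bullet> u) * (x \<bullet> v) * (x \<bullet> (c *\<^sub>R w))) *\<^sub>R x \<partial>\<mu>) =
      c *\<^sub>R (\<integral>x. ((x \<bullet> u) * (x \<bullet> v) * (x \<bullet> w)) *\<^sub>R x \<partial>\<mu>)"
      by (subst integral_scaleR_right[symmetric])
        (auto intro!: integrable_vector simp: mult.left_commute simp del: integral_scaleR_right)
  qed
  then show ?thesis
    unfolding moment_op_def by (simp add: bounded_linear_Blinfun_apply linear_conv_bounded_linear)
qed

lemma inner_moment_op: "moment_op u v w \<bullet> z = moment4 u v w z"
  unfolding moment_op_apply moment4_def
  by (subst integral_inner_left[symmetric]) (auto intro: integrable_vector)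

lemma integrable_moment4: "integrable \<mu> (\<lambda>x. (x \<bullet> u) * (x \<bullet> v) * (x \<bullet> w) * (x \<bullet> z))"
  using integrable_inner_left[OF integrable_vector[of u v w], of z] by simp

lemma moment4_commute:
  "moment4 v u w z = moment4 u v w z" "moment4 u w v z = moment4 u v w z"
  "moment4 u v z w = moment4 u v w z"
  by (simp_all add: moment4_def mult_ac)

lemma moment4_linear4:
  "moment4 u v w (y + z) = moment4 u v w y + moment4 u v w z"
  "moment4 u v w (y - z) = moment4 u v w y - moment4 u v w z"
  "moment4 u v w (c *\<^sub>R z) = c * moment4 u v w z"
  by (simp_all add: inner_moment_op[symmetric] inner_add_right inner_diff_right)

lemma moment4_linear3:
  "moment4 u v (y + z) w = moment4 u v y w + moment4 u v z w"
  "moment4 u v (y - z) w = moment4 u v y w - moment4 u v z w"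
  "moment4 u v (c *\<^sub>R z) w = c * moment4 u v z w"
  using moment4_linear4[of u v w] moment4_commute(3)[of u v w] by simp_all

lemma moment4_linear2:
  "moment4 u (y + z) v w = moment4 u y v w + moment4 u z v w"
  "moment4 u (y - z) v w = moment4 u y v w - moment4 u z v w"
  "moment4 u (c *\<^sub>R z) v w = c * moment4 u z v w"
  using moment4_linear3[of u v _ _ w] moment4_commute(2)[of u v _ w]
  by simp_all

lemma moment4_linear1:
  "moment4 (y + z) u v w = moment4 y u v w + moment4 z u v w"
  "moment4 (y - z) u v w = moment4 y u v w - moment4 z u v w"
  "moment4 (c *\<^sub>R z) u v w = c * moment4 z u v w"
  using moment4_linear2[of u _ _ v w] moment4_commute(1)[of u _ v w]
  by simp_all

text \<open>Multilinearity expands, and ordered rewriting with adjacent transpositions sorts the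
  arguments, so identities between quartic forms reduce to comparing monomials.\<close>

lemmas moment4_simps = moment4_linear1 moment4_linear2 moment4_linear3 moment4_linear4
  moment4_commute

lemma bounded_bilinear_moment_op: "bounded_bilinear moment_op"
  unfolding bilinear_conv_bounded_bilinear[symmetric] bilinear_def
proof (intro conjI allI linearI blinfun_eqI; rule vector_eq_rdot[THEN iffD1], rule allI)
qed (simp_all add: blinfun.add_left blinfun.scaleR_left inner_add_left inner_moment_op
      moment4_linear1 moment4_linear2)

lemmas continuous_on_moment_op = bounded_bilinear.continuous_on[OF bounded_bilinear_moment_op]

section \<open>The quartic excess risk and its behaviour near the true parameter\<close>

definition square_dev :: "'a \<Rightarrow> 'a \<Rightarrow> real" where
  "square_dev b a = (\<integral>x. ((x \<bullet> a)\<^sup>2 - (x \<bullet> b)\<^sup>2)\<^sup>2 \<partial>\<mu>)"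

lemma square_dev_eq: "square_dev b a = moment4 a a a a - 2 * moment4 a a b b + moment4 b b b b"
proof -
  have "square_dev b a = (\<integral>x. (x \<bullet> a) * (x \<bullet> a) * (x \<bullet> a) * (x \<bullet> a)
      - 2 * ((x \<bullet> a) * (x \<bullet> a) * (x \<bullet> b) * (x \<bullet> b)) + (x \<bullet> b) * (x \<bullet> b) * (x \<bullet> b) * (x \<bullet> b) \<partial>\<mu>)"
    unfolding square_dev_def
    by (intro Bochner_Integration.integral_cong refl) (simp add: power2_eq_square algebra_simps)
  also have "\<dots> = moment4 a a a a - 2 * moment4 a a b b + moment4 b b b b"
    unfolding moment4_def
    by (subst Bochner_Integration.integral_add Bochner_Integration.integral_diff
        integral_mult_right_zero;
        (intro Bochner_Integration.integrable_add Bochner_Integration.integrable_diff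
          integrable_mult_right integrable_moment4)?)+ simp
  finally show ?thesis .
qed

lemma square_dev_nonneg: "0 \<le> square_dev b a" and square_dev_self: "square_dev b b = 0"
  by (simp_all add: square_dev_def)

text \<open>The factorization <x, a>^2 - <x, b>^2 = <x, a - b> <x, a + b>, squared and
  integrated.\<close>

lemma square_dev_factor: "square_dev b a = (a - b) \<bullet> moment_op (a + b) (a + b) (a - b)"
  unfolding inner_commute[of "a - b"] inner_moment_op square_dev_eq by (simp add: moment4_simps)

text \<open>The quadratic form is E <y, b>^2 <y, v>^2, which vanishes only if the product is zero
  almost everywhere. Its minimum over the compact sphere is therefore positive, and homogeneity
  extends the bound to all vectors.\<close>

lemma coercive_moment_op:
  assumes nd: "\<And>v. v \<in> sphere 0 1 \<Longrightarrow> \<not> (AE y in \<mu>. (y \<bullet> b) * (y \<bullet> v) = 0)"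
  shows "\<exists>c>0. coercive c (moment_op b b)"
proof -
  have pos: "0 < moment4 b b v v" if "v \<in> sphere 0 1" for v
  proof -
    have int: "integrable \<mu> (\<lambda>y. ((y \<bullet> b) * (y \<bullet> v))\<^sup>2)"
      using integrable_moment4[of b b v v] by (simp add: power2_eq_square mult_ac)
    have "moment4 b b v v = (\<integral>y. ((y \<bullet> b) * (y \<bullet> v))\<^sup>2 \<partial>\<mu>)"
      by (simp add: moment4_def power2_eq_square mult_ac)
    moreover have "\<dots> \<noteq> 0"
      using nd[OF that] integral_nonneg_eq_0_iff_AE[OF int] by simp
    moreover have "0 \<le> (\<integral>y. ((y \<bullet> b) * (y \<bullet> v))\<^sup>2 \<partial>\<mu>)" by simp
    ultimately show ?thesis by linarith
  qed
  have cont: "continuous_on (sphere 0 1) (\<lambda>v. moment4 b b v v)"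
    unfolding inner_moment_op[symmetric] by (intro continuous_intros)
  have ne: "sphere (0::'a) 1 \<noteq> {}" by simp
  obtain v0 where v0: "v0 \<in> sphere 0 1"
    "\<And>v. v \<in> sphere 0 1 \<Longrightarrow> moment4 b b v0 v0 \<le> moment4 b b v v"
    using continuous_attains_inf[OF compact_sphere ne cont] by auto
  have "moment4 b b v0 v0 * (norm h)\<^sup>2 \<le> h \<bullet> moment_op b b h" for h
  proof (cases "h = 0")
    case False
    then have "h /\<^sub>R norm h \<in> sphere 0 1" by simp
    from v0(2)[OF this] have "moment4 b b v0 v0 \<le> moment4 b b h h / (norm h)\<^sup>2"
      by (simp add: moment4_linear3 moment4_linear4 divide_inverse power2_eq_square mult_ac)
    then show ?thesis using False by (simp add: inner_commute[of h] inner_moment_op field_simps)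
  qed simp
  then show ?thesis using pos[OF v0(1)] unfolding coercive_def by blast
qed

text \<open>In the factored form the operator at \<open>a + b\<close> is close to four times the one
  at \<open>b\<close> and keeps half of its coercivity. Strictness is only local because
  \<open>- b\<close> is a zero as well.\<close>

lemma square_dev_strict_min:
  assumes "coercive c (moment_op b b)" "0 < c"
  shows "\<exists>r>0. \<forall>a\<in>cball b r. a \<noteq> b \<longrightarrow> 0 < square_dev b a"
proof -
  have "isCont (\<lambda>a. moment_op (a + b) (a + b)) b"
    using continuous_on_moment_op[of UNIV "\<lambda>a. a + b" "\<lambda>a. a + b"]
    by (simp add: continuous_on_eq_continuous_at continuous_intros)
  then have "\<forall>\<^sub>F a in nhds b. dist (moment_op (a + b) (a + b)) (moment_op (b + b) (b + b)) < 2 * c"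
    unfolding continuous_at tendsto_at_iff_tendsto_nhds[of "\<lambda>a. moment_op (a + b) (a + b)"]
    by (rule tendstoD) (use assms(2) in simp)
  then obtain r where r: "0 < r"
    "\<And>a. dist a b < r \<Longrightarrow> dist (moment_op (a + b) (a + b)) (moment_op (b + b) (b + b)) < 2 * c"
    unfolding eventually_nhds_metric by blast
  have c4: "coercive (4 * c) (moment_op (b + b) (b + b))"
    unfolding coercive_def
  proof
    fix h
    have "h \<bullet> moment_op (b + b) (b + b) h = 4 * (h \<bullet> moment_op b b h)"
      unfolding inner_commute[of h] inner_moment_op by (simp add: moment4_linear1 moment4_linear2)
    then show "4 * c * (norm h)\<^sup>2 \<le> h \<bullet> moment_op (b + b) (b + b) h"
      using assms(1) unfolding coercive_def by (simp add: mult.assoc)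
  qed
  have "0 < square_dev b a" if a: "a \<in> cball b (r / 2)" "a \<noteq> b" for a
  proof -
    have "norm (moment_op (a + b) (a + b) - moment_op (b + b) (b + b)) \<le> 2 * c"
      using r(2)[of a] r(1) a by (simp add: dist_norm norm_minus_commute)
    from coercive_perturb[OF c4 this]
    have "2 * c * (norm (a - b))\<^sup>2 \<le> square_dev b a" unfolding square_dev_factor coercive_def by simp
    moreover have "0 < 2 * c * (norm (a - b))\<^sup>2" using a assms(2) by simp
    ultimately show ?thesis by linarith
  qed
  then show ?thesis using r(1) by (intro exI[of _ "r / 2"]) auto
qed

text \<open>Both problems share this reduction: the slope data of the objective come from the
  quartic excess risk, and only the data of the parametrization \<phi> differ.\<close>

lemma tilt_stable_if_nondegenerate:
  fixes \<phi> :: "'a \<Rightarrow> 'p::euclidean_space" and f :: "'p \<Rightarrow> real"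
    and P :: "'a \<times> 'a \<Rightarrow> 'a \<Rightarrow>\<^sub>L 'p" and T :: "'a \<Rightarrow> 'p \<Rightarrow>\<^sub>L 'a" and B :: "'p \<Rightarrow>\<^sub>L ('a \<Rightarrow>\<^sub>L 'a)"
  assumes nd: "\<And>v. v \<in> sphere 0 1 \<Longrightarrow> \<not> (AE y in \<mu>. (y \<bullet> b) * (y \<bullet> v) = 0)"
    and f: "\<And>a. f (\<phi> a) = k * square_dev b a + C" "0 < k"
    and P: "\<And>a a'. \<phi> a - \<phi> a' = P (a, a') (a - a')" "continuous_on UNIV P"
    and T: "\<And>a V h. V \<bullet> P (a, a) h = T a V \<bullet> h" "continuous_on UNIV T"
      "\<And>a a' V. T a V - T a' V = B V (a - a')"
    and into: "0 < r" "\<And>a. a \<in> cball b r \<Longrightarrow> \<phi> a \<in> M"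
    and onto: "\<And>r. 0 < r \<Longrightarrow> \<exists>e>0. M \<inter> cball (\<phi> b) e \<subseteq> \<phi> ` cball b r"
    and min: "\<phi> b \<in> argmin_set f M"
  shows "tilt_stable_minimizer UNIV M f (\<phi> b)"
proof -
  obtain c where c: "0 < c" "coercive c (moment_op b b)" using coercive_moment_op[OF nd] by blast
  obtain r1 where r1: "0 < r1" "\<And>a. a \<in> cball b r1 \<Longrightarrow> a \<noteq> b \<Longrightarrow> 0 < square_dev b a"
    using square_dev_strict_min[OF c(2,1)] by blast
  \<comment> \<open>The slope of the gradient, from the identity a^3 - c^3 = (a^2 + a c + c^2) (a -
    c) applied to moments; at (b, b) it is the Hessian \<open>8 * k\<close> times
    \<open>moment_op b b\<close>.\<close>
  define A where "A p = (4 * k) *\<^sub>R (moment_op (fst p) (fst p) + moment_op (fst p) (snd p)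
    + moment_op (snd p) (snd p) - moment_op b b)" for p
  \<comment> \<open>From a^4 - c^4 - 2 b^2 (a^2 - c^2) = (a^2 + c^2 - 2 b^2) (a + c) (a - c); on the
    diagonal it is the gradient.\<close>
  define L where "L p = k *\<^sub>R (moment_op (fst p) (fst p) + moment_op (snd p) (snd p)
    - 2 *\<^sub>R moment_op b b) (fst p + snd p)" for p
  note op_left = blinfun.add_left blinfun.diff_left blinfun.scaleR_left
  show ?thesis
  proof (rule tilt_stable_minimizer_param[where L=L and A=A and c="8 * k * c",
        OF _ _ _ _ _ _ r1(1) _ P T into onto min])
    show "f (\<phi> a) - f (\<phi> a') = L (a, a') \<bullet> (a - a')" for a a'
    proof -
      have "f (\<phi> a) - f (\<phi> a') = k * (square_dev b a - square_dev b a')" by (simp add: f algebra_simps)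
      also have "\<dots> = L (a, a') \<bullet> (a - a')"
        by (simp add: L_def op_left inner_add_left inner_diff_left inner_moment_op square_dev_eq moment4_simps algebra_simps)
      finally show ?thesis .
    qed
    show "L (a, a) - L (a', a') = A (a, a') (a - a')" for a a'
    proof -
      have "(L (a, a) - L (a', a')) \<bullet> z = A (a, a') (a - a') \<bullet> z" for z
        by (simp add: L_def A_def op_left inner_add_left inner_diff_left inner_moment_op moment4_simps algebra_simps)
      then show ?thesis using vector_eq_rdot by blast
    qed
    show "continuous_on UNIV L" "continuous_on UNIV A"
      unfolding L_def[abs_def] A_def[abs_def] by (intro continuous_intros continuous_on_moment_op)+
    show "coercive (8 * k * c) (A (b, b))"
      unfolding coercive_def
    proof
      fix h
      have "h \<bullet> A (b, b) h = 8 * k * (h \<bullet> moment_op b b h)"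
        by (simp add: A_def op_left inner_add_right inner_diff_right)
      then show "8 * k * c * (norm h)\<^sup>2 \<le> h \<bullet> A (b, b) h"
        using c(2) f(2) unfolding coercive_def by (simp add: mult.assoc)
    qed
    show "0 < 8 * k * c" using f(2) c(1) by simp
    show "f (\<phi> b) < f (\<phi> a)" if "a \<in> cball b r1" "a \<noteq> b" for a
      using r1(2)[OF that] f(2) by (simp add: f(1) square_dev_self)
  qed
qed

text \<open>Every moment containing both \<open>b\<close> and \<open>v\<close> vanishes, so
  expanding the factored form at \<open>b + t *\<^sub>R v\<close> leaves only the pure quartic
  term.\<close>

lemma square_dev_degenerate:
  assumes "AE y in \<mu>. (y \<bullet> b) * (y \<bullet> v) = 0"
  shows "square_dev b (b + t *\<^sub>R v) = t ^ 4 * moment4 v v v v"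
proof -
  have 0: "moment4 v v b w = 0" for w
  proof -
    have "moment4 v v b w = (\<integral>x. 0 \<partial>\<mu>)"
      unfolding moment4_def using assms P4_sets[OF P4]
      by (intro integral_cong_AE) (auto simp: measurable_cong_sets[of \<mu> borel] elim: eventually_mono)
    then show ?thesis by simp
  qed
  have "square_dev b (b + t *\<^sub>R v) = (t *\<^sub>R v) \<bullet> moment_op ((2 *\<^sub>R b) + t *\<^sub>R v) ((2 *\<^sub>R b) + t *\<^sub>R v) (t *\<^sub>R v)"
    unfolding square_dev_factor by (simp add: scaleR_2 add_ac)
  also have "\<dots> = t ^ 4 * moment4 v v v v"
    unfolding inner_commute[of "t *\<^sub>R v"] inner_moment_op
    using 0[of b] 0[of v] by (simp add: moment4_simps power4_eq_xxxx)
  finally show ?thesis .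
qed

end

subsection \<open>Expected square loss\<close>

text \<open>The coordinates of a product space are independent, so \<open>phase_joint_law\<close>
  applies with the product as sample space. Integrals against the joint law become accessible to
  Fubini.\<close>

lemma joint_law_phase_kernel:
  fixes \<mu> :: "'a::euclidean_space measure" and N :: "real measure"
  assumes \<mu>: "prob_space \<mu>" "sets \<mu> = sets borel" and N: "prob_space N" "sets N = sets borel"
  shows "joint_law \<mu> (phase_kernel b N) =
    distr (\<mu> \<Otimes>\<^sub>M N) borel (\<lambda>w. (fst w, (fst w \<bullet> b)\<^sup>2 + snd w))"
proof -
  note [measurable_cong] = \<mu>(2) N(2)
  interpret M: prob_space \<mu> by fact
  interpret N: prob_space N by fact
  interpret P: pair_prob_space \<mu> N ..
  have vimage: "fst -` A \<inter> space (\<mu> \<Otimes>\<^sub>M N) = A \<times> space N" "snd -` B \<inter> space (\<mu> \<Otimes>\<^sub>M N) = space \<mu> \<times> B"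
    if "A \<in> sets borel" "B \<in> sets borel" for A B
    using that sets.sets_into_space[of A \<mu>] sets.sets_into_space[of B N] \<mu>(2) N(2)
    by (auto simp: space_pair_measure)
  have "indep_of (\<mu> \<Otimes>\<^sub>M N) fst snd"
    unfolding indep_of_def
  proof (rule P.indep_setI)
    fix a c
    assume "a \<in> {fst -` A \<inter> space (\<mu> \<Otimes>\<^sub>M N) |A. A \<in> sets borel}"
      and "c \<in> {snd -` B \<inter> space (\<mu> \<Otimes>\<^sub>M N) |B. B \<in> sets borel}"
    then obtain A B where "A \<in> sets borel" "B \<in> sets borel"
      "a = fst -` A \<inter> space (\<mu> \<Otimes>\<^sub>M N)" "c = snd -` B \<inter> space (\<mu> \<Otimes>\<^sub>M N)"
      by blast
    then have AB: "A \<in> sets borel" "B \<in> sets borel" "a = A \<times> space N" "c = space \<mu> \<times> B"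
      by (simp_all add: vimage)
    have sub: "A \<subseteq> space \<mu>" "B \<subseteq> space N"
      using AB sets.sets_into_space[of A \<mu>] sets.sets_into_space[of B N] \<mu>(2) N(2) by auto
    have times: "P.prob (X \<times> Y) = M.prob X * N.prob Y" if "X \<in> sets \<mu>" "Y \<in> sets N" for X Y
      using that by (simp add: measure_def N.emeasure_pair_measure_Times enn2real_mult)
    have "a \<inter> c = A \<times> B" using AB sub by auto
    then show "P.prob (a \<inter> c) = P.prob a * P.prob c"
      using AB times[of A B] times[of A "space N"] times[of "space \<mu>" B]
        sets.top[of \<mu>] sets.top[of N] \<mu>(2) N(2)
      by (simp add: M.prob_space N.prob_space)
  qed (auto intro!: measurable_sets[of _ _ borel])
  from phase_joint_law[OF P.prob_space_axioms _ _ this, of b] show ?thesis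
    by (simp add: distr_pair_borel assms)
qed

text \<open>Bias-variance decomposition: the cross term vanishes because the noise is centred and
  independent of the features. The quadratic growth bound on \<open>p\<close> makes the squared bias
  integrable under a finite fourth moment.\<close>

lemma integral_joint_law_square:
  fixes \<mu> :: "'a::euclidean_space measure" and N :: "real measure"
  assumes \<mu>: "\<mu> \<in> P4" and N: "prob_space N" "sets N = sets borel"
    and N2: "integrable N (\<lambda>e. e\<^sup>2)" and N0: "(\<integral>e. e \<partial>N) = 0"
    and p: "p \<in> borel_measurable borel" "\<And>x. \<bar>p x\<bar> \<le> C * (norm x)\<^sup>2"
  shows "(\<integral>z. (p (fst z) - snd z)\<^sup>2 \<partial>joint_law \<mu> (phase_kernel b N)) =
    (\<integral>x. (p x - (x \<bullet> b)\<^sup>2)\<^sup>2 \<partial>\<mu>) + (\<integral>e. e\<^sup>2 \<partial>N)"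
proof -
  note [measurable_cong] = P4_sets[OF \<mu>] N(2)
  note [measurable] = p(1)
  interpret M: prob_space \<mu> by (rule P4_prob_space[OF \<mu>])
  interpret N: prob_space N by fact
  interpret P: pair_prob_space \<mu> N ..
  define r where "r x = p x - (x \<bullet> b)\<^sup>2" for x
  have [measurable]: "r \<in> borel_measurable borel" unfolding r_def by measurable
  have "\<bar>r x\<bar> \<le> (C + (norm b)\<^sup>2) * (norm x)\<^sup>2" for x
  proof -
    have "(x \<bullet> b)\<^sup>2 \<le> (norm x * norm b)\<^sup>2"
      by (metis Cauchy_Schwarz_ineq2 abs_ge_zero power2_abs power_mono)
    then show ?thesis using p(2)[of x] zero_le_power2[of "x \<bullet> b"]
      unfolding r_def power_mult_distrib distrib_right mult.commute[of "(norm b)\<^sup>2"] by linarith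
  qed
  then have "(r x)\<^sup>2 \<le> ((C + (norm b)\<^sup>2) * (norm x)\<^sup>2)\<^sup>2" for x
    by (metis abs_ge_zero power2_abs power_mono)
  moreover have "((C + (norm b)\<^sup>2) * (norm x)\<^sup>2)\<^sup>2 \<le> (C + (norm b)\<^sup>2)\<^sup>2 * (1 + norm x ^ 4)" for x :: 'a
    unfolding power_mult_distrib power_mult[symmetric] by (intro mult_left_mono) auto
  ultimately have int_r: "integrable \<mu> (\<lambda>x. (r x)\<^sup>2)"
    by (intro P4_integrable[OF \<mu>, where C="(C + (norm b)\<^sup>2)\<^sup>2"]) (measurable, auto intro: order_trans)
  have I1: "integrable (\<mu> \<Otimes>\<^sub>M N) (\<lambda>w. (r (fst w))\<^sup>2)"
    using int_r by (intro integrable_distr[of fst _ \<mu>]) (simp_all add: N.distr_pair_fst)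
  have E1: "(\<integral>w. (r (fst w))\<^sup>2 \<partial>(\<mu> \<Otimes>\<^sub>M N)) = (\<integral>x. (r x)\<^sup>2 \<partial>\<mu>)"
    using P.integral_fst'[OF I1] by (simp add: N.prob_space)
  have I2: "integrable (\<mu> \<Otimes>\<^sub>M N) (\<lambda>w. (snd w)\<^sup>2)"
  proof (rule P.Fubini_integrable)
    show "integrable \<mu> (\<lambda>x. \<integral>y. norm ((snd (x, y))\<^sup>2) \<partial>N)" by simp
  qed (use N2 in auto)
  have E2: "(\<integral>w. (snd w)\<^sup>2 \<partial>(\<mu> \<Otimes>\<^sub>M N)) = (\<integral>e. e\<^sup>2 \<partial>N)"
    using P.integral_fst'[OF I2] by (simp add: M.prob_space)
  \<comment> \<open>The cross term is dominated by the sum of the two squares.\<close>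
  have I3: "integrable (\<mu> \<Otimes>\<^sub>M N) (\<lambda>w. 2 * r (fst w) * snd w)"
  proof (rule Bochner_Integration.integrable_bound[OF Bochner_Integration.integrable_add[OF I1 I2]])
    have "\<bar>2 * x * y\<bar> \<le> \<bar>x\<^sup>2 + y\<^sup>2\<bar>" for x y :: real
      using zero_le_power2[of "x + y"] zero_le_power2[of "x - y"]
      by (simp add: power2_sum power2_diff abs_le_iff abs_of_nonneg)
    then show "AE w in \<mu> \<Otimes>\<^sub>M N. norm (2 * r (fst w) * snd w) \<le> norm ((r (fst w))\<^sup>2 + (snd w)\<^sup>2)"
      by simp
  qed measurable
  have E3: "(\<integral>w. 2 * r (fst w) * snd w \<partial>(\<mu> \<Otimes>\<^sub>M N)) = 0"
    using P.integral_fst'[OF I3] by (simp add: N0)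
  have "(\<integral>z. (p (fst z) - snd z)\<^sup>2 \<partial>joint_law \<mu> (phase_kernel b N)) =
      (\<integral>w. (p (fst w) - ((fst w \<bullet> b)\<^sup>2 + snd w))\<^sup>2 \<partial>(\<mu> \<Otimes>\<^sub>M N))"
    unfolding joint_law_phase_kernel[OF P4_prob_space[OF \<mu>] P4_sets[OF \<mu>] N]
    by (subst integral_distr) (simp_all flip: borel_prod)
  also have "\<dots> = (\<integral>w. (r (fst w))\<^sup>2 + (snd w)\<^sup>2 - 2 * r (fst w) * snd w \<partial>(\<mu> \<Otimes>\<^sub>M N))"
    by (intro Bochner_Integration.integral_cong refl) (simp add: r_def power2_eq_square algebra_simps)
  also have "\<dots> = (\<integral>x. (r x)\<^sup>2 \<partial>\<mu>) + (\<integral>e. e\<^sup>2 \<partial>N)"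
    using I1 I2 I3 by (simp add: E1 E2 E3)
  finally show ?thesis by (simp add: r_def)
qed

subsection \<open>Rank-one matrices\<close>

text \<open>The polarization of \<open>outer\<close>: bilinearity supplies slopes and expansions
  along curves.\<close>

definition tensor :: "real ^ 'n \<Rightarrow> real ^ 'n \<Rightarrow> real ^ 'n ^ 'n" where
  "tensor u v = (\<chi> i j. u $ i * v $ j)"

lemma outer_eq_tensor: "outer u = tensor u u"
  by (simp add: outer_def tensor_def)

lemma bounded_bilinear_tensor: "bounded_bilinear (tensor :: real ^ 'n \<Rightarrow> _)"
  unfolding bilinear_conv_bounded_bilinear[symmetric] bilinear_def
  by (auto intro!: linearI simp: tensor_def vec_eq_iff algebra_simps)

interpretation tensor: bounded_bilinear "tensor :: real ^ 'n \<Rightarrow> real ^ 'n \<Rightarrow> _"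
  by (rule bounded_bilinear_tensor)

lemma tensor_mult_vec: "tensor u v *v x = (v \<bullet> x) *\<^sub>R u"
  by (simp add: vec_eq_iff tensor_def matrix_vector_mult_def inner_vec_def sum_distrib_left
      sum_distrib_right mult_ac)

lemma inner_tensor: "V \<bullet> tensor u v = u \<bullet> (V *v v)"
  by (simp add: tensor_def matrix_vector_mult_def inner_vec_def sum_distrib_left mult_ac)

lemma inner_mult_vec_transpose: "u \<bullet> (V *v v) = (transpose V *v u) \<bullet> v"
  for V :: "real ^ 'n ^ 'm"
  by (simp add: dot_lmul_matrix)

lemma inner_outer: "outer u \<bullet> outer v = (u \<bullet> v)\<^sup>2"
  by (simp add: outer_eq_tensor inner_tensor tensor_mult_vec power2_eq_square inner_commute)

lemma outer_minus: "outer (- u) = outer u"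
  by (simp add: outer_def)

lemma quadratic_form_outer: "x \<bullet> (outer u *v x) = (x \<bullet> u)\<^sup>2"
  by (simp add: outer_eq_tensor tensor_mult_vec power2_eq_square inner_commute)

text \<open>Local injectivity of \<open>outer\<close> with a linear rate; the sign condition selects
  between \<open>a\<close> and \<open>- a\<close>, which have the same image.\<close>

lemma norm_outer_diff:
  assumes "0 \<le> a \<bullet> b"
  shows "(norm (a - b) * norm b)\<^sup>2 \<le> 2 * (norm (outer a - outer b))\<^sup>2"
proof -
  define s t w where "s = a \<bullet> a" and "t = b \<bullet> b" and "w = a \<bullet> b"
  have st: "0 \<le> s" "0 \<le> t" "0 \<le> w" using assms by (simp_all add: s_def t_def w_def)
  have nab: "(norm (a - b))\<^sup>2 = s + t - 2 * w"
    by (simp add: power2_norm_eq_inner s_def t_def w_def inner_simps inner_commute)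
  have "(norm (a - b) * norm b)\<^sup>2 = (s + t - 2 * w) * t"
    unfolding power_mult_distrib nab by (simp add: power2_norm_eq_inner t_def)
  also have "\<dots> \<le> (s + t - 2 * w) * (s + t + 2 * w)"
    using st zero_le_power2[of "norm (a - b)"] by (intro mult_left_mono) (auto simp: nab)
  also have "\<dots> = (s + t)\<^sup>2 - 4 * w\<^sup>2" by (simp add: power2_eq_square algebra_simps)
  \<comment> \<open>The two sides differ by (s - t)^2.\<close>
  also have "\<dots> \<le> 2 * (s\<^sup>2 + t\<^sup>2 - 2 * w\<^sup>2)"
    using zero_le_power2[of "s - t"] by (simp add: power2_sum power2_diff)
  also have "s\<^sup>2 + t\<^sup>2 - 2 * w\<^sup>2 = (norm (outer a - outer b))\<^sup>2"
    unfolding power2_norm_eq_inner inner_diff_left inner_diff_right inner_outer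
    by (simp add: s_def t_def w_def inner_commute)
  finally show ?thesis .
qed

section \<open>Positive semidefinite matrices of rank one as outer products\<close>

lemma outer_psd_rank1:
  fixes u :: "real ^ 'n"
  assumes "u \<noteq> 0"
  shows "outer u \<in> {M \<in> psd_mats. rank M = 1}"
proof -
  have "outer u \<in> psd_mats"
    by (simp add: psd_mats_def sym_mats_def quadratic_form_outer)
      (simp add: outer_def transpose_def vec_eq_iff mult.commute)
  moreover have "range (\<lambda>x. outer u *v x) = span {u}"
  proof
    show "range (\<lambda>x. outer u *v x) \<subseteq> span {u}"
      by (auto simp: outer_eq_tensor tensor_mult_vec span_singleton)
    show "span {u} \<subseteq> range (\<lambda>x. outer u *v x)"
    proof
      fix y assume "y \<in> span {u}"
      then obtain c where "y = c *\<^sub>R u" by (auto simp: span_singleton)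
      then have "y = outer u *v ((c / (u \<bullet> u)) *\<^sub>R u)"
        using assms by (simp add: outer_eq_tensor tensor_mult_vec)
      then show "y \<in> range (\<lambda>x. outer u *v x)" by blast
    qed
  qed
  then have "rank (outer u) = 1"
    unfolding rank_dim_range using assms by (simp add: dim_insert)
  ultimately show ?thesis by simp
qed

text \<open>The range is a line spanned by some w, symmetry forces the matrix to be a multiple of w
  w^T, and semidefiniteness makes the multiple nonnegative, so its root can be absorbed into
  w.\<close>

lemma psd_rank1_outer:
  fixes M :: "real ^ 'n ^ 'n"
  assumes "M \<in> psd_mats" "rank M = 1"
  shows "\<exists>u. M = outer u"
proof -
  have sym: "transpose M = M" and psd: "\<And>u. 0 \<le> u \<bullet> (M *v u)"
    using assms(1) by (auto simp: psd_mats_def sym_mats_def)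
  obtain W where W: "W \<subseteq> range (\<lambda>x. M *v x)" "independent W"
    "range (\<lambda>x. M *v x) \<subseteq> span W" "card W = 1"
    using basis_exists[of "range (\<lambda>x. M *v x)"] assms(2) unfolding rank_dim_range by metis
  then obtain w where w: "W = {w}" by (auto simp: card_1_singleton_iff)
  then have "w \<noteq> 0" using W(2) by (auto simp: dependent_zero)
  have "\<forall>x. \<exists>c. M *v x = c *\<^sub>R w" using W(3) unfolding w span_singleton by blast
  then obtain c where c: "\<And>x. M *v x = c x *\<^sub>R w" by metis
  \<comment> \<open>Pairing the equation for \<open>M *v x\<close> with \<open>w\<close> and using
    symmetry gives c(x) = l <x, w>.\<close>
  define l where "l = c w / (w \<bullet> w)"
  have "c x * (w \<bullet> w) = c w * (x \<bullet> w)" for x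
    using inner_mult_vec_transpose[of x M w] unfolding sym c by simp
  then have Mx: "M *v x = l *\<^sub>R ((w \<bullet> x) *\<^sub>R w)" for x
    using \<open>w \<noteq> 0\<close> by (simp add: l_def c inner_commute nonzero_eq_divide_eq)
  have "0 < w \<bullet> w" using \<open>w \<noteq> 0\<close> by simp
  moreover have "0 \<le> c w * (w \<bullet> w)" using psd[of w] by (simp add: c)
  ultimately have "0 \<le> c w" by (smt (verit) mult_neg_pos)
  then have "0 \<le> l" using \<open>w \<noteq> 0\<close> by (simp add: l_def)
  then have "M *v x = outer (sqrt l *\<^sub>R w) *v x" for x
    unfolding Mx outer_eq_tensor tensor_mult_vec by (simp add: mult_ac)
  then show ?thesis using matrix_eq by blast
qed

subsection \<open>Exceptional laws of phase retrieval\<close>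

lemma add_scaleR_unit_nonzero:
  fixes b v :: "'a::real_normed_vector"
  assumes "norm v = 1" "0 < t" "t < norm b"
  shows "b + t *\<^sub>R v \<noteq> 0"
proof
  assume "b + t *\<^sub>R v = 0"
  then have "b = - (t *\<^sub>R v)" by (simp add: eq_neg_iff_add_eq_0)
  then show False using assms by simp
qed

text \<open>The line from \<open>b\<close> in the degenerate direction \<open>v\<close>, tilted
  along \<open>v\<close>, meets the quartic growth criterion.\<close>

lemma not_tilt_stable_vector:
  fixes b :: "'a::euclidean_space"
  assumes \<mu>: "\<mu> \<in> P4" and b: "b \<noteq> 0"
    and v: "v \<in> sphere 0 1" "AE y in \<mu>. (y \<bullet> b) * (y \<bullet> v) = 0"
    and f: "\<And>a. f a = k * P4_law.square_dev \<mu> b a + C"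
  shows "\<not> tilt_stable_minimizer UNIV (UNIV - {0}) f b"
proof -
  interpret P4_law \<mu> by (unfold_locales, fact)
  define q where "q = k * moment4 v v v v"
  have nv: "norm v = 1" "v \<bullet> v = 1" using v(1) by (simp_all add: norm_eq_1)
  show ?thesis
  proof (rule not_tilt_stable_minimizer_quartic[where A=v and a=1 and \<delta>="norm b"
        and p="\<lambda>t. b + t *\<^sub>R v" and C="\<bar>q\<bar> + 1"])
    fix t :: real assume t: "0 < t" "t < norm b"
    have "b + t *\<^sub>R v \<noteq> 0" using t nv by (intro add_scaleR_unit_nonzero) auto
    then show "b + t *\<^sub>R v \<in> UNIV - {0}" by simp
    have "q * t ^ 4 \<le> (\<bar>q\<bar> + 1) * t ^ 4" using t by (intro mult_right_mono) auto
    then show "f (b + t *\<^sub>R v) \<le> f b + (\<bar>q\<bar> + 1) * t ^ 4"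
      by (simp add: f square_dev_degenerate[OF v(2)] square_dev_self q_def mult_ac)
    show "1 * t - (\<bar>q\<bar> + 1) * t\<^sup>2 \<le> v \<bullet> (b + t *\<^sub>R v - b)"
      using nv by simp
    show "norm (b + t *\<^sub>R v - b) \<le> (\<bar>q\<bar> + 1) * t"
      using t nv by (simp add: distrib_right)
  qed (use b in auto)
qed

text \<open>The same line mapped by \<open>outer\<close> is a curve of feasible matrices with
  velocity \<open>A\<close> and second-order term \<open>B\<close>; tilting along \<open>A\<close>
  rewards moving on it.\<close>

lemma not_tilt_stable_matrix:
  fixes b :: "real ^ 'n" and f :: "real ^ 'n ^ 'n \<Rightarrow> real"
  assumes \<mu>: "\<mu> \<in> P4" and b: "b \<noteq> 0"
    and v: "v \<in> sphere 0 1" "AE y in \<mu>. (y \<bullet> b) * (y \<bullet> v) = 0"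
    and f: "\<And>a. f (outer a) = k * P4_law.square_dev \<mu> b a + C"
  shows "\<not> tilt_stable_minimizer sym_mats {M \<in> psd_mats. rank M = 1} f (outer b)"
proof -
  interpret P4_law \<mu> by (unfold_locales, fact)
  define A where "A = tensor b v + tensor v b"
  define B where "B = outer v"
  define q where "q = k * moment4 v v v v"
  \<comment> \<open>One constant for all three bounds: quartic growth, the loss from
    \<open>B\<close> in the direction of \<open>A\<close>, and the length of the curve.\<close>
  define R where "R = \<bar>q\<bar> + norm A * norm B + norm A + norm B"
  have nv: "norm v = 1" "v \<bullet> v = 1" using v(1) by (simp_all add: norm_eq_1)
  have "0 \<le> norm A * norm B" by simp
  then have R: "q \<le> R" "- (A \<bullet> B) \<le> R" "norm A + norm B \<le> R"
    using Cauchy_Schwarz_ineq2[of A B] norm_ge_zero[of A] norm_ge_zero[of B]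
    unfolding R_def by linarith+
  have curve: "outer (b + t *\<^sub>R v) - outer b = t *\<^sub>R A + t\<^sup>2 *\<^sub>R B" for t
    by (simp add: outer_eq_tensor A_def B_def tensor.add_left tensor.add_right
        tensor.scaleR_left tensor.scaleR_right algebra_simps power2_eq_square)
  \<comment> \<open>A bilinear value that is at least |b|^2 certifies that the velocity is
    nonzero.\<close>
  have "v \<bullet> (A *v b) = (b \<bullet> v)\<^sup>2 + b \<bullet> b"
    using nv by (simp add: A_def matrix_vector_mult_add_rdistrib tensor_mult_vec inner_add_right
        power2_eq_square inner_commute)
  also have "\<dots> > 0" using b by (simp add: add_nonneg_pos)
  finally have "A \<noteq> 0" by auto
  have "subspace (sym_mats :: (real ^ 'n ^ 'n) set)"
    by (auto simp: subspace_def sym_mats_def transpose_def vec_eq_iff)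
  moreover have "A \<in> sym_mats"
    by (auto simp: A_def sym_mats_def transpose_def tensor_def vec_eq_iff mult.commute)
  ultimately show ?thesis
  proof (rule not_tilt_stable_minimizer_quartic[where a="(norm A)\<^sup>2" and \<delta>="min 1 (norm b)"
        and p="\<lambda>t. outer (b + t *\<^sub>R v)" and C=R])
    show "0 < (norm A)\<^sup>2" using \<open>A \<noteq> 0\<close> by simp
    show "0 < min 1 (norm b)" using b by simp
    fix t :: real assume t: "0 < t" "t < min 1 (norm b)"
    have "b + t *\<^sub>R v \<noteq> 0" using t nv by (intro add_scaleR_unit_nonzero) auto
    then show "outer (b + t *\<^sub>R v) \<in> {M \<in> psd_mats. rank M = 1}" by (rule outer_psd_rank1)
    have "q * t ^ 4 \<le> R * t ^ 4" by (intro mult_right_mono R) simp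
    then show "f (outer (b + t *\<^sub>R v)) \<le> f (outer b) + R * t ^ 4"
      by (simp add: f square_dev_degenerate[OF v(2)] square_dev_self q_def mult_ac)
    have "t\<^sup>2 * (- (A \<bullet> B)) \<le> t\<^sup>2 * R"
      by (intro mult_left_mono R) simp
    then show "(norm A)\<^sup>2 * t - R * t\<^sup>2 \<le> A \<bullet> (outer (b + t *\<^sub>R v) - outer b)"
      unfolding curve by (simp add: inner_add_right power2_norm_eq_inner mult_ac)
    have "t\<^sup>2 * norm B \<le> t * norm B"
      using t by (intro mult_right_mono) (auto simp: power2_eq_square)
    then have "norm (t *\<^sub>R A + t\<^sup>2 *\<^sub>R B) \<le> t * norm A + t * norm B"
      using t norm_triangle_ineq[of "t *\<^sub>R A" "t\<^sup>2 *\<^sub>R B"] by simp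
    also have "\<dots> \<le> R * t"
      using t R(3) by (simp add: mult_right_mono mult.commute[of t] flip: distrib_right)
    finally show "norm (outer (b + t *\<^sub>R v) - outer b) \<le> R * t" unfolding curve .
  qed
qed

section \<open>Nondegenerate laws: tilt-stability\<close>

lemma tilt_stable_vector:
  fixes b :: "'a::euclidean_space"
  assumes \<mu>: "\<mu> \<in> P4" and b: "b \<noteq> 0"
    and nd: "\<And>v. v \<in> sphere 0 1 \<Longrightarrow> \<not> (AE y in \<mu>. (y \<bullet> b) * (y \<bullet> v) = 0)"
    and f: "\<And>a. f a = k * P4_law.square_dev \<mu> b a + C" "0 < k"
  shows "tilt_stable_minimizer UNIV (UNIV - {0}) f b"
proof -
  interpret P4_law \<mu> by (unfold_locales, fact)
  show ?thesis
  \<comment> \<open>The identity is the parametrization; its slope is constant, so the curvature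
    term \<open>B\<close> is zero.\<close>
  proof (rule tilt_stable_if_nondegenerate[where \<phi>="\<lambda>a. a" and P="\<lambda>_. id_blinfun"
        and T="\<lambda>_. id_blinfun" and B=0, OF nd f])
    \<comment> \<open>This radius keeps the ball around \<open>b\<close> away from the removed
      origin.\<close>
    show "0 < norm b / 2" using b by simp
    show "a \<in> UNIV - {0}" if "a \<in> cball b (norm b / 2)" for a
      using that b by auto
    show "\<exists>e>0. (UNIV - {0}) \<inter> cball b e \<subseteq> (\<lambda>a. a) ` cball b r" if "0 < r" for r
      using that by (intro exI[of _ r]) auto
    show "b \<in> argmin_set f (UNIV - {0})"
      using b f(2) square_dev_nonneg
      by (auto simp: argmin_set_def is_arg_min_def f(1) square_dev_self not_less)
  qed auto
qed

lemma tilt_stable_matrix: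
  fixes b :: "real ^ 'n" and f :: "real ^ 'n ^ 'n \<Rightarrow> real"
  assumes \<mu>: "\<mu> \<in> P4" and b: "b \<noteq> 0"
    and nd: "\<And>v. v \<in> sphere 0 1 \<Longrightarrow> \<not> (AE y in \<mu>. (y \<bullet> b) * (y \<bullet> v) = 0)"
    and f: "\<And>a. f (outer a) = k * P4_law.square_dev \<mu> b a + C" "0 < k"
  shows "tilt_stable_minimizer sym_mats {M \<in> psd_mats. rank M = 1} f (outer b)"
proof (rule tilt_stable_minimizer_subspace)
  interpret P4_law \<mu> by (unfold_locales, fact)
  \<comment> \<open>The gradient in \<open>a\<close> of the tilt \<open>V \<bullet> outer a\<close>,
    namely (V + V^T) a.\<close>
  define sm where "sm V a = V *v a + transpose V *v a" for V :: "real ^ 'n ^ 'n" and a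
  interpret sm: bounded_bilinear sm
    unfolding bilinear_conv_bounded_bilinear[symmetric] bilinear_def sm_def
    by (auto intro!: linearI simp: matrix_vector_mult_add_rdistrib matrix_vector_right_distrib
        matrix_vector_mult_scaleR scaleR_matrix_vector_assoc vector_matrix_mult_def
        matrix_vector_mult_def transpose_def vec_eq_iff algebra_simps sum.distrib sum_distrib_left)
  \<comment> \<open>Encodes a a^T - c c^T = (a - c) a^T + c (a - c)^T.\<close>
  define P where "P p = tensor.prod_left (fst p) + tensor.prod_right (snd p)"
    for p :: "(real ^ 'n) \<times> (real ^ 'n)"
  show "0 \<in> (sym_mats :: (real ^ 'n ^ 'n) set)"
    by (simp add: sym_mats_def transpose_def vec_eq_iff)
  show "tilt_stable_minimizer UNIV {M \<in> psd_mats. rank M = 1} f (outer b)"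
  proof (rule tilt_stable_if_nondegenerate[where \<phi>=outer and P=P
        and T=sm.prod_left and B="Blinfun sm.prod_right", OF nd f])
    show "outer a - outer a' = P (a, a') (a - a')" for a a'
      by (simp add: P_def blinfun.add_left outer_eq_tensor tensor.diff_left tensor.diff_right)
    show "continuous_on UNIV P"
      unfolding P_def[abs_def] by (intro continuous_intros)
    show "V \<bullet> P (a, a) h = sm.prod_left a V \<bullet> h" for a V h
      by (simp add: P_def blinfun.add_left inner_add_right inner_tensor sm_def
          inner_mult_vec_transpose[of a V h] inner_add_left inner_commute[of h] del: transpose_matrix_vector)
    show "continuous_on UNIV sm.prod_left"
      by (rule linear_continuous_on[OF sm.bounded_linear_prod_left])
    show "sm.prod_left a V - sm.prod_left a' V = Blinfun sm.prod_right V (a - a')" for a a' V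
      by (simp add: bounded_linear_Blinfun_apply sm.bounded_linear_prod_right sm.diff_right)
    show "0 < norm b / 2" using b by simp
    show "outer a \<in> {M \<in> psd_mats. rank M = 1}" if "a \<in> cball b (norm b / 2)" for a
      using that b by (intro outer_psd_rank1) auto
    show "\<exists>e>0. {M \<in> psd_mats. rank M = 1} \<inter> cball (outer b) e \<subseteq> outer ` cball b r"
      if r: "0 < r" for r
    proof (intro exI conjI subsetI)
      \<comment> \<open>Half of \<open>r * norm b\<close> absorbs the factor 2 in
        \<open>norm_outer_diff\<close>.\<close>
      show "0 < r * norm b / 2" using r b by simp
      fix M assume M: "M \<in> {M \<in> psd_mats. rank M = 1} \<inter> cball (outer b) (r * norm b / 2)"
      then obtain u where u: "M = outer u" using psd_rank1_outer[of M] by auto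
      \<comment> \<open>Of the two preimages of \<open>M\<close>, the one on the side of
        \<open>b\<close>.\<close>
      define a where "a = (if 0 \<le> u \<bullet> b then u else - u)"
      have a: "M = outer a" "0 \<le> a \<bullet> b" by (auto simp: a_def u outer_minus)
      have "(norm (a - b) * norm b)\<^sup>2 \<le> 2 * (norm (outer a - outer b))\<^sup>2"
        by (rule norm_outer_diff[OF a(2)])
      also have "\<dots> \<le> 2 * (r * norm b / 2)\<^sup>2"
        using M by (intro mult_left_mono power_mono) (auto simp: a(1) dist_norm norm_minus_commute)
      also have "\<dots> \<le> (r * norm b)\<^sup>2" by (simp add: power_divide)
      finally have "norm (a - b) * norm b \<le> r * norm b"
        by (rule power2_le_imp_le) (use r in simp)
      then have "a \<in> cball b r" using b by (simp add: dist_norm norm_minus_commute)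
      then show "M \<in> outer ` cball b r" using a(1) by blast
    qed
    show "outer b \<in> argmin_set f {M \<in> psd_mats. rank M = 1}"
    proof -
      have "f (outer b) \<le> f M" if "M \<in> psd_mats" "rank M = 1" for M
      proof -
        obtain u where "M = outer u" using psd_rank1_outer[OF \<open>M \<in> psd_mats\<close> \<open>rank M = 1\<close>] by blast
        then show ?thesis using f(2) square_dev_nonneg[of b u] by (simp add: f(1) square_dev_self)
      qed
      then show ?thesis
        using outer_psd_rank1[OF b] by (auto simp: argmin_set_def is_arg_min_def not_less)
    qed
  qed
qed

section \<open>Identification of the exceptional laws and the radius\<close>

lemma
  fixes b :: "real ^ 'n"
  assumes \<mu>: "\<mu> \<in> P4" and N: "prob_space N" "sets N = sets borel"
    and N2: "integrable N (\<lambda>e. e\<^sup>2)" and N0: "(\<integral>e. e \<partial>N) = 0"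
  shows expected_vector_loss: "expected_loss vector_loss (joint_law \<mu> (phase_kernel b N)) a =
      1/8 * P4_law.square_dev \<mu> b a + 1/8 * (\<integral>e. e\<^sup>2 \<partial>N)"
    and expected_matrix_loss: "expected_loss matrix_loss (joint_law \<mu> (phase_kernel b N)) (outer a) =
      1/2 * P4_law.square_dev \<mu> b a + 1/2 * (\<integral>e. e\<^sup>2 \<partial>N)"
proof -
  interpret P4_law \<mu> by (unfold_locales, fact)
  have "(x \<bullet> a)\<^sup>2 \<le> (norm a)\<^sup>2 * (norm x)\<^sup>2" for x
    by (metis Cauchy_Schwarz_ineq2 abs_ge_zero mult.commute power2_abs power_mono power_mult_distrib)
  then have "(\<integral>z. ((fst z \<bullet> a)\<^sup>2 - snd z)\<^sup>2 \<partial>joint_law \<mu> (phase_kernel b N)) =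
      square_dev b a + (\<integral>e. e\<^sup>2 \<partial>N)"
    unfolding square_dev_def
    by (intro integral_joint_law_square[OF \<mu> N N2 N0, where C="(norm a)\<^sup>2"]) auto
  then show
    "expected_loss vector_loss (joint_law \<mu> (phase_kernel b N)) a = 1/8 * square_dev b a + 1/8 * (\<integral>e. e\<^sup>2 \<partial>N)"
    "expected_loss matrix_loss (joint_law \<mu> (phase_kernel b N)) (outer a) = 1/2 * square_dev b a + 1/2 * (\<integral>e. e\<^sup>2 \<partial>N)"
    by (simp_all add: expected_loss_def vector_loss_def matrix_loss_def quadratic_form_outer
        case_prod_unfold)
qed

text \<open>Nondegeneracy gives tilt-stability and degeneracy excludes it, with the same dichotomy
  in both problems. This is why the two radii coincide.\<close>

lemma exceptional_laws_phase:
  fixes b :: "real ^ 'n"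
  assumes b: "b \<noteq> 0" and N: "prob_space N" "sets N = sets borel"
    and N2: "integrable N (\<lambda>e. e\<^sup>2)" and N0: "(\<integral>e. e \<partial>N) = 0"
  shows exceptional_laws_vector:
      "exceptional_laws UNIV (UNIV - {0}) vector_loss b (phase_kernel b N) = orthogonal_laws b"
    and exceptional_laws_matrix:
      "exceptional_laws sym_mats {M \<in> psd_mats. rank M = 1} matrix_loss (outer b) (phase_kernel b N)
        = orthogonal_laws b"
proof -
  note eL = expected_vector_loss[OF _ N N2 N0, of _ b] and eM = expected_matrix_loss[OF _ N N2 N0, of _ b]
  have "tilt_stable_minimizer UNIV (UNIV - {0}) (expected_loss vector_loss (joint_law \<mu> (phase_kernel b N))) b
      \<longleftrightarrow> \<not> (\<exists>v\<in>sphere 0 1. AE y in \<mu>. (y \<bullet> b) * (y \<bullet> v) = 0)" if "\<mu> \<in> P4" for \<mu>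
    using tilt_stable_vector[OF that b _ eL[OF that]] not_tilt_stable_vector[OF that b _ _ eL[OF that]]
    by (auto simp del: mult_eq_0_iff)
  then show "exceptional_laws UNIV (UNIV - {0}) vector_loss b (phase_kernel b N) = orthogonal_laws b"
    unfolding exceptional_laws_def orthogonal_laws_def by blast
  have "tilt_stable_minimizer sym_mats {M \<in> psd_mats. rank M = 1}
        (expected_loss matrix_loss (joint_law \<mu> (phase_kernel b N))) (outer b)
      \<longleftrightarrow> \<not> (\<exists>v\<in>sphere 0 1. AE y in \<mu>. (y \<bullet> b) * (y \<bullet> v) = 0)" if "\<mu> \<in> P4" for \<mu>
    using tilt_stable_matrix[OF that b _ eM[OF that]] not_tilt_stable_matrix[OF that b _ _ eM[OF that]]
    by (auto simp del: mult_eq_0_iff)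
  then show "exceptional_laws sym_mats {M \<in> psd_mats. rank M = 1} matrix_loss (outer b) (phase_kernel b N)
      = orthogonal_laws b"
    unfolding exceptional_laws_def orthogonal_laws_def by blast
qed

theorem theorem5p2:
  fixes \<Omega> :: "'w measure" and x :: "'w \<Rightarrow> real ^ 'n" and \<epsilon> :: "'w \<Rightarrow> real"
    and \<beta> :: "real ^ 'n" and Dx :: "(real ^ 'n) measure"
    and D :: "((real ^ 'n) \<times> real) measure" and K :: "real ^ 'n \<Rightarrow> real measure"
  assumes "\<beta> \<noteq> 0"
    and "prob_space \<Omega>"
    and "x \<in> borel_measurable \<Omega>" and "\<epsilon> \<in> borel_measurable \<Omega>"
    and "indep_of \<Omega> x \<epsilon>"
    and "integrable \<Omega> (\<lambda>\<omega>. (\<epsilon> \<omega>)\<^sup>2)" and "(\<integral>\<omega>. \<epsilon> \<omega> \<partial>\<Omega>) = 0"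
    and "Dx = distr \<Omega> borel x" and "Dx \<in> P4"
    and "D = distr \<Omega> borel (\<lambda>\<omega>. (x \<omega>, (x \<omega> \<bullet> \<beta>)\<^sup>2 + \<epsilon> \<omega>))"
    and "K = phase_kernel \<beta> (distr \<Omega> borel \<epsilon>)"
  shows
    "is_minimum
       ((\<lambda>v. ereal (sqrt (\<integral>z. min ((z \<bullet> (\<beta> /\<^sub>R norm \<beta>))\<^sup>2) ((z \<bullet> v)\<^sup>2) \<partial>Dx))) ` sphere 0 1)
       (RSE sym_mats {M \<in> psd_mats. rank M = 1} matrix_loss (outer \<beta>) K D)
     \<and>
     is_minimum
       ((\<lambda>v. ereal (sqrt (\<integral>z. min ((z \<bullet> (\<beta> /\<^sub>R norm \<beta>))\<^sup>2) ((z \<bullet> v)\<^sup>2) \<partial>Dx))) ` sphere 0 1)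
       (RSE UNIV (UNIV - {0}) vector_loss \<beta> K D)"
proof -
  note [measurable] = assms(3,4)
  have pair: "(\<lambda>\<omega>. (x \<omega>, (x \<omega> \<bullet> \<beta>)\<^sup>2 + \<epsilon> \<omega>)) \<in> \<Omega> \<rightarrow>\<^sub>M borel"
    unfolding borel_prod[symmetric] by measurable
  \<comment> \<open>The feature marginal of \<open>D\<close> is \<open>Dx\<close>, so the radius is
    a distance measured from \<open>Dx\<close>.\<close>
  have fst: "distr D borel fst = Dx"
    unfolding assms(8,10)
    by (subst distr_distr[OF _ pair])
      (auto simp: comp_def intro!: borel_measurable_continuous_onI continuous_intros)
  have N: "prob_space (distr \<Omega> borel \<epsilon>)" "sets (distr \<Omega> borel \<epsilon>) = sets borel"
    "integrable (distr \<Omega> borel \<epsilon>) (\<lambda>e. e\<^sup>2)" "(\<integral>e. e \<partial>distr \<Omega> borel \<epsilon>) = 0"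
    using assms(6,7) by (simp_all add: prob_space.prob_space_distr[OF assms(2)] integrable_distr_eq integral_distr)
  show ?thesis
    unfolding RSE_def fst assms(11) exceptional_laws_vector[OF assms(1) N]
      exceptional_laws_matrix[OF assms(1) N]
    using W2_setdist_orthogonal_laws[OF assms(9,1)] by blast
qed

end
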